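(* Let $0<t<1$ and let $\rho_n$ be the density of eigenvalues for the potential $V(z)=|z|^2-\mathrm{Re}(tz^2)$. Let $z_0,a\in\mathbb C$. Then $$\lim_{n\to\infty}\rho_n\left(z_0+\frac a{\sqrt n}\right)=\frac1\pi\begin{cases}1&\text{if }z_0\text{ lies inside of }\partial E_t,\\ \frac12\,\mathrm{erfc}(\zeta(a))&\text{if }z_0\in\partial E_t,\\0&\text{if }z_0\text{ lies outside of }\partial E_t,\end{cases}$$ with $$\zeta(a)=\frac{\sqrt2\left((1-t)\cos\phi\,\mathrm{Re}\,a+(1+t)\sin\phi\,\mathrm{Im}\,a\right)}{\sqrt{(1+t)^2-4t\cos^2\phi}},$$ where $\phi$ is the parameter such that $z_0=a_t\cos\phi+i\,b_t\sin\phi$ (when $z_0\in\partial E_t$).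
   Context: For $n\in\mathbb N$, let $(p_{k,n})_{k\ge0}$ be the polynomials with $\deg p_{k,n}=k$ and positive leading coefficient satisfying $\int_{\mathbb C}\overline{p_{k,n}(z)}p_{l,n}(z)e^{-nV(z)}\,d^2z=\delta_{kl}$ ($d^2z$ is Lebesgue measure). The density of eigenvalues is $\rho_n(z)=\frac1n e^{-nV(z)}\sum_{k=0}^{n-1}|p_{k,n}(z)|^2$. Let $a_t=\sqrt{\frac{1+t}{1-t}}$, $b_t=\sqrt{\frac{1-t}{1+t}}$ and let $\partial E_t=\{z\in\mathbb C:\frac{(\mathrm{Re}\,z)^2}{a_t^2}+\frac{(\mathrm{Im}\,z)^2}{b_t^2}=1\}$; "inside" means $\frac{(\mathrm{Re}\,z)^2}{a_t^2}+\frac{(\mathrm{Im}\,z)^2}{b_t^2}<1$ and "outside" means $>1$. $\mathrm{erfc}(z)=\frac{2}{\sqrt\pi}\int_z^\infty e^{-w^2}dw$. *)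

theory Defs
  imports "HOL-Analysis.Analysis" "HOL-Computational_Algebra.Polynomial"
begin

definition orthonormal_polys :: "(complex \<Rightarrow> real) \<Rightarrow> nat \<Rightarrow> (nat \<Rightarrow> complex poly) \<Rightarrow> bool" where
  "orthonormal_polys V n p \<longleftrightarrow>
     (\<forall>k. degree (p k) = k \<and> lead_coeff (p k) \<in> \<real> \<and> 0 < Re (lead_coeff (p k))) \<and>
     (\<forall>k l. has_bochner_integral lborel
        (\<lambda>z. cnj (poly (p k) z) * poly (p l) z * complex_of_real (exp (- (real n * V z))))
        (if k = l then 1 else 0))"

(* Meaningful only if the orthonormal family exists (it is then unique). For n = 0 the weight
   is constant, so no such family exists; this case is irrelevant for limits n -> infinity. *)
definition orthonormal_poly :: "(complex \<Rightarrow> real) \<Rightarrow> nat \<Rightarrow> nat \<Rightarrow> complex poly" where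
  "orthonormal_poly V n = (THE p. orthonormal_polys V n p)"

definition eigenvalue_density :: "(complex \<Rightarrow> real) \<Rightarrow> nat \<Rightarrow> complex \<Rightarrow> real" where
  "eigenvalue_density V n z =
     1 / real n * exp (- (real n * V z)) * (\<Sum>k<n. (cmod (poly (orthonormal_poly V n k) z))\<^sup>2)"

definition elliptic_potential :: "real \<Rightarrow> complex \<Rightarrow> real" where
  "elliptic_potential t z = (cmod z)\<^sup>2 - Re (complex_of_real t * z\<^sup>2)"

definition semi_axis_re :: "real \<Rightarrow> real" where
  "semi_axis_re t = sqrt ((1 + t) / (1 - t))"

definition semi_axis_im :: "real \<Rightarrow> real" where
  "semi_axis_im t = sqrt ((1 - t) / (1 + t))"

definition ellipse_form :: "real \<Rightarrow> complex \<Rightarrow> real" where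
  "ellipse_form t z = (Re z)\<^sup>2 / (semi_axis_re t)\<^sup>2 + (Im z)\<^sup>2 / (semi_axis_im t)\<^sup>2"

definition ellipse_boundary :: "real \<Rightarrow> complex set" where
  "ellipse_boundary t = {z. ellipse_form t z = 1}"

definition ellipse_inside :: "real \<Rightarrow> complex set" where
  "ellipse_inside t = {z. ellipse_form t z < 1}"

definition ellipse_outside :: "real \<Rightarrow> complex set" where
  "ellipse_outside t = {z. ellipse_form t z > 1}"

(* Only real arguments occur, so the path from x to infinity is the half-line. *)
definition erfc :: "real \<Rightarrow> real" where
  "erfc x = 2 / sqrt pi * (LBINT w:{x..}. exp (- (w\<^sup>2)))"

definition edge_zeta :: "real \<Rightarrow> real \<Rightarrow> complex \<Rightarrow> real" where
  "edge_zeta t \<phi> a =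
     sqrt 2 * ((1 - t) * cos \<phi> * Re a + (1 + t) * sin \<phi> * Im a)
       / sqrt ((1 + t)\<^sup>2 - 4 * t * (cos \<phi>)\<^sup>2)"

end

theory Submission
  imports Defs "HOL-Probability.Probability" "HOL-Complex_Analysis.Complex_Analysis"
begin

text \<open>
  The orthogonal polynomials are rescaled Hermite polynomials \<open>h\<^sub>k\<close>, and Mehler's formula sums
  \<open>\<Sum>\<^sub>k s\<^sup>k \<bar>h\<^sub>k(z)\<bar>\<^sup>2 / (k! \<lambda>\<^sup>k)\<close> in closed form. Hence \<open>\<pi> \<rho>\<^sub>n(z) = P(X < n)\<close> for a random variable \<open>X\<close> on
  the natural numbers with probability generating function
  \<open>sqrt ((1 - t\<^sup>2) / (1 - t\<^sup>2 s\<^sup>2)) exp (n (G(s) - G(1)))\<close>, where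
  \<open>G(s) = (1 - t\<^sup>2) (x\<^sup>2 s / (1 + t s) + y\<^sup>2 s / (1 - t s))\<close> and \<open>z = x + i y\<close>.
  Its mean is asymptotically \<open>n G'(1)\<close>, and \<open>G'(1)\<close> is the quadratic form that defines the ellipse.
  Inside and outside the ellipse a Chernoff bound with \<open>s\<close> close to \<open>1\<close> gives the limits \<open>1\<close> and \<open>0\<close>;
  on the ellipse \<open>X\<close> satisfies a central limit theorem, the shift of \<open>z\<close> by \<open>a / sqrt n\<close> moves the mean
  by order \<open>sqrt n\<close>, and the normal distribution function yields the complementary error function.
\<close>

subsection \<open>Gaussian integrals over the complex plane\<close>

text \<open>For t = 0 the variable X would be Poisson with mean n |z|^2; the elliptic case keeps the
  same mechanism with a different exponent G. Two demands shape the work. The tail bound inside the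
  ellipse needs generating-function arguments s > 1, and the characteristic function needs |s| = 1,
  so a formula for small s is too weak. Mehler's formula is therefore proved on the whole disc |s| <
  1/t, which contains the closed unit circle because t < 1: formal power series identify the
  coefficients through a differential equation, and holomorphy of the closed form on the disc gives
  convergence there.

  The variance of X is asymptotically n times the value at s = 1 of (s d/ds)^2 G, which is positive
  on the ellipse. The square-root prefactor does not grow with n: it is a constant in the tail
  bounds and tends to 1 in the central limit theorem.

  No explicit formula for the Hermite polynomials is used. Orthogonality comes from an adjoint
  relation, obtained by integrating by parts in the two real coordinates, in which the weight is a
  product.\<close>

lemma borel_measurable_Complex_pair:
  "(\<lambda>p. Complex (fst p) (snd p)) \<in> borel_measurable (lborel \<Otimes>\<^sub>M lborel)"
proof -
  have "(\<lambda>p. complex_of_real (fst p) + \<i> * complex_of_real (snd p)) \<in> borel_measurable (lborel \<Otimes>\<^sub>M lborel)"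
    by measurable
  then show ?thesis by (simp add: Complex_eq)
qed

text \<open>Lebesgue measure is determined by its values on boxes, and a box in the plane is a
  product of intervals. This is what makes Fubini's theorem available for integrals over complex
  numbers.\<close>

lemma lborel_complex_distr:
  "(lborel :: complex measure) = distr (lborel \<Otimes>\<^sub>M lborel) borel (\<lambda>p. Complex (fst p) (snd p))"
proof (rule lborel_eqI)
  fix l u :: complex
  assume le: "\<And>b. b \<in> Basis \<Longrightarrow> l \<bullet> b \<le> u \<bullet> b"
  have "(\<lambda>p. Complex (fst p) (snd p)) -` box l u \<inter> space (lborel \<Otimes>\<^sub>M lborel)
      = {Re l<..<Re u} \<times> {Im l<..<Im u}"
    by (auto simp: box_def Basis_complex_def space_pair_measure inner_complex_def)
  then show "emeasure (distr (lborel \<Otimes>\<^sub>M lborel) borel (\<lambda>p. Complex (fst p) (snd p))) (box l u)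
      = ennreal (\<Prod>b\<in>Basis. (u - l) \<bullet> b)"
    using le[of 1] le[of \<i>] borel_measurable_Complex_pair
    by (simp add: emeasure_distr lborel.emeasure_pair_measure_Times Basis_complex_def
        ennreal_mult'' inner_complex_def)
qed simp

lemma has_bochner_integral_Re_Im:
  fixes f g :: "real \<Rightarrow> real"
  assumes f: "has_bochner_integral lborel f A" and g: "has_bochner_integral lborel g B"
  shows "has_bochner_integral lborel (\<lambda>z. complex_of_real (f (Re z) * g (Im z))) (complex_of_real (A * B))"
proof -
  have [measurable]: "f \<in> borel_measurable borel" "g \<in> borel_measurable borel"
    using f g by (auto simp: has_bochner_integral_iff)
  have fi: "integrable lborel f" "integral\<^sup>L lborel f = A" and gi: "integrable lborel g" "integral\<^sup>L lborel g = B"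
    using f g by (auto simp: has_bochner_integral_iff)
  have int: "integrable (lborel \<Otimes>\<^sub>M lborel) (\<lambda>(x,y). f x * g y)"
  proof (rule lborel_pair.Fubini_integrable)
    show "(\<lambda>(x, y). f x * g y) \<in> borel_measurable (lborel \<Otimes>\<^sub>M lborel)" by measurable
    show "integrable lborel (\<lambda>x. LBINT y. norm (case (x, y) of (x, y) \<Rightarrow> f x * g y))"
      using fi gi by (simp add: norm_mult abs_mult)
    show "AE x in lborel. integrable lborel (\<lambda>y. case (x, y) of (x, y) \<Rightarrow> f x * g y)"
      using gi by simp
  qed
  have "(LINT p|(lborel \<Otimes>\<^sub>M lborel). (case p of (x,y) \<Rightarrow> f x * g y)) = (LBINT x. LBINT y. f x * g y)"
    using lborel_pair.integral_fst'[OF int] by simp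
  also have "\<dots> = A * B" using fi gi by simp
  finally have "has_bochner_integral (lborel \<Otimes>\<^sub>M lborel) (\<lambda>p. f (fst p) * g (snd p)) (A * B)"
    using int by (simp add: has_bochner_integral_iff case_prod_beta')
  then have "has_bochner_integral (lborel \<Otimes>\<^sub>M lborel) (\<lambda>p. complex_of_real (f (fst p) * g (snd p))) (complex_of_real (A * B))"
    by (rule has_bochner_integral_of_real)
  then show ?thesis
    unfolding lborel_complex_distr
    by (subst has_bochner_integral_iff, subst integrable_distr_eq[OF borel_measurable_Complex_pair], simp,
        subst integral_distr[OF borel_measurable_Complex_pair]) (auto simp: has_bochner_integral_iff)
qed

section \<open>Gaussian moments in one variable\<close>

definition gauss_moment :: "real \<Rightarrow> nat \<Rightarrow> real" where
  "gauss_moment \<alpha> i = (LBINT x. x ^ i * exp (- (\<alpha> * x\<^sup>2)))"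

lemma exp_square_conv_normal_density:
  fixes \<alpha> :: real
  assumes "\<alpha> > 0"
  obtains \<sigma> where "\<sigma> > 0" "\<sigma>\<^sup>2 = 1 / (2 * \<alpha>)"
    "\<And>x. sqrt (pi / \<alpha>) * normal_density 0 \<sigma> x = exp (- (\<alpha> * x\<^sup>2))"
proof
  define \<sigma> where "\<sigma> = sqrt (1 / (2 * \<alpha>))"
  show s: "\<sigma> > 0" "\<sigma>\<^sup>2 = 1 / (2 * \<alpha>)" using assms by (auto simp: \<sigma>_def)
  show "sqrt (pi / \<alpha>) * normal_density 0 \<sigma> x = exp (- (\<alpha> * x\<^sup>2))" for x
    unfolding normal_density_def s using assms by (simp add: real_sqrt_divide real_sqrt_mult field_simps)
qed

lemma gauss_moment_even:
  fixes \<alpha> :: real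
  assumes "\<alpha> > 0"
  shows "has_bochner_integral lborel (\<lambda>x. x ^ (2 * k) * exp (- (\<alpha> * x\<^sup>2)))
     (sqrt (pi / \<alpha>) * (fact (2 * k) / ((4 * \<alpha>) ^ k * fact k)))"
proof -
  obtain \<sigma> where s: "\<sigma> > 0" "\<sigma>\<^sup>2 = 1 / (2 * \<alpha>)"
    and d: "\<And>x. sqrt (pi / \<alpha>) * normal_density 0 \<sigma> x = exp (- (\<alpha> * x\<^sup>2))"
    using exp_square_conv_normal_density[OF assms] by metis
  show ?thesis unfolding d[symmetric]
    using has_bochner_integral_mult_right[OF normal_moment_even[OF s(1), of 0 k], of "sqrt (pi / \<alpha>)"] s(2)
    by (simp add: mult_ac)
qed

lemma gauss_moment_odd:
  fixes \<alpha> :: real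
  assumes "\<alpha> > 0"
  shows "has_bochner_integral lborel (\<lambda>x. x ^ (2 * k + 1) * exp (- (\<alpha> * x\<^sup>2))) 0"
proof -
  obtain \<sigma> where s: "\<sigma> > 0" "\<sigma>\<^sup>2 = 1 / (2 * \<alpha>)"
    and d: "\<And>x. sqrt (pi / \<alpha>) * normal_density 0 \<sigma> x = exp (- (\<alpha> * x\<^sup>2))"
    using exp_square_conv_normal_density[OF assms] by metis
  show ?thesis unfolding d[symmetric]
    using has_bochner_integral_mult_right[OF normal_moment_odd[OF s(1), of 0 k], of "sqrt (pi / \<alpha>)"] s(2)
    by (simp add: mult_ac)
qed

lemma has_integral_gauss_moment:
  assumes "\<alpha> > 0"
  shows "has_bochner_integral lborel (\<lambda>x. x ^ i * exp (- (\<alpha> * x\<^sup>2))) (gauss_moment \<alpha> i)"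
proof (cases "even i")
  case True
  then obtain k where "i = 2 * k" by (elim evenE)
  then show ?thesis using gauss_moment_even[OF assms, of k]
    by (simp add: gauss_moment_def has_bochner_integral_iff)
next
  case False
  then obtain k where "i = 2 * k + 1" by (elim oddE)
  then show ?thesis using gauss_moment_odd[OF assms, of k]
    by (simp add: gauss_moment_def has_bochner_integral_iff)
qed

lemma gauss_moment_0: "\<alpha> > 0 \<Longrightarrow> gauss_moment \<alpha> 0 = sqrt (pi / \<alpha>)"
  using gauss_moment_even[of \<alpha> 0] by (simp add: gauss_moment_def has_bochner_integral_iff)

text \<open>This is integration by parts of \<open>x ^ i\<close> against the derivative of the
  Gaussian, read off from the explicit moments: odd ones vanish and even ones are quotients of
  factorials. For \<open>i = 0\<close> the truncated index \<open>i - 1\<close> is multiplied by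
  0.\<close>

lemma gauss_moment_Suc:
  assumes "\<alpha> > 0"
  shows "2 * \<alpha> * gauss_moment \<alpha> (Suc i) = real i * gauss_moment \<alpha> (i - 1)"
proof (cases "even i")
  case True
  then obtain k where k: "i = 2 * k" by (elim evenE)
  have "gauss_moment \<alpha> (Suc i) = 0" using gauss_moment_odd[OF assms, of k] k
    by (simp add: gauss_moment_def has_bochner_integral_iff)
  moreover have "real i * gauss_moment \<alpha> (i - 1) = 0"
  proof (cases k)
    case (Suc j)
    then have "i - 1 = 2 * j + 1" using k by simp
    then show ?thesis using gauss_moment_odd[OF assms, of j]
      by (simp add: gauss_moment_def has_bochner_integral_iff)
  qed (simp add: k)
  ultimately show ?thesis by simp
next
  case False
  then obtain k where k: "i = 2 * k + 1" by (elim oddE)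
  then have i: "Suc i = 2 * Suc k" "i - 1 = 2 * k" by auto
  have "gauss_moment \<alpha> (2 * j) = sqrt (pi / \<alpha>) * (fact (2 * j) / ((4 * \<alpha>) ^ j * fact j))" for j
    using gauss_moment_even[OF assms, of j] by (simp add: gauss_moment_def has_bochner_integral_iff)
  note e = this
  have "(fact (2 * Suc k) :: real) = (2 * k + 2) * ((2 * k + 1) * fact (2 * k))"
    by (simp add: algebra_simps)
  then show ?thesis unfolding i e using assms
    by (simp add: k divide_simps del: fact_Suc mult_Suc_right) (simp add: algebra_simps)
qed

text \<open>\<open>poly_xy F Fx Fy\<close>: \<open>F\<close> is a complex polynomial in the real variables \<open>Re z\<close>, \<open>Im z\<close>
  with partial derivatives \<open>Fx\<close>, \<open>Fy\<close>.\<close>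

inductive poly_xy :: "(complex \<Rightarrow> complex) \<Rightarrow> (complex \<Rightarrow> complex) \<Rightarrow> (complex \<Rightarrow> complex) \<Rightarrow> bool" where
  poly_xy_monom: "poly_xy (\<lambda>z. of_real (Re z ^ i * Im z ^ j)) (\<lambda>z. of_real (real i * Re z ^ (i - 1) * Im z ^ j))
     (\<lambda>z. of_real (real j * Re z ^ i * Im z ^ (j - 1)))"
| poly_xy_scale: "poly_xy F Fx Fy \<Longrightarrow> poly_xy (\<lambda>z. c * F z) (\<lambda>z. c * Fx z) (\<lambda>z. c * Fy z)"
| poly_xy_add: "poly_xy F Fx Fy \<Longrightarrow> poly_xy G Gx Gy \<Longrightarrow>
     poly_xy (\<lambda>z. F z + G z) (\<lambda>z. Fx z + Gx z) (\<lambda>z. Fy z + Gy z)"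

lemma poly_xy_const: "poly_xy (\<lambda>z. c) (\<lambda>z. 0) (\<lambda>z. 0)"
  using poly_xy_scale[OF poly_xy_monom[of 0 0], of c] by simp

lemma poly_xy_times_Re:
  "poly_xy F Fx Fy \<Longrightarrow> poly_xy (\<lambda>z. of_real (Re z) * F z) (\<lambda>z. F z + of_real (Re z) * Fx z) (\<lambda>z. of_real (Re z) * Fy z)"
proof (induction rule: poly_xy.induct)
  case (poly_xy_monom i j)
  have "real (Suc i) * Re z ^ (Suc i - 1) * Im z ^ j
      = Re z ^ i * Im z ^ j + Re z * (real i * Re z ^ (i - 1) * Im z ^ j)" for z
    by (cases i) (auto simp: algebra_simps)
  then have e: "complex_of_real (real (Suc i) * Re z ^ (Suc i - 1) * Im z ^ j)
      = of_real (Re z ^ i * Im z ^ j) + of_real (Re z) * of_real (real i * Re z ^ (i - 1) * Im z ^ j)" for z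
    by (metis of_real_add of_real_mult)
  have e1: "complex_of_real (Re z ^ Suc i * Im z ^ j) = of_real (Re z) * of_real (Re z ^ i * Im z ^ j)"
    "complex_of_real (real j * Re z ^ Suc i * Im z ^ (j - 1)) = of_real (Re z) * of_real (real j * Re z ^ i * Im z ^ (j - 1))" for z
    by (simp_all add: mult_ac)
  show ?case using poly_xy.poly_xy_monom[of "Suc i" j] unfolding e e1 .
next
  case (poly_xy_scale F Fx Fy c)
  show ?case using poly_xy.poly_xy_scale[OF poly_xy_scale.IH, of c] by (simp add: algebra_simps)
next
  case (poly_xy_add F Fx Fy G Gx Gy)
  show ?case using poly_xy.poly_xy_add[OF poly_xy_add.IH] by (simp add: algebra_simps)
qed

lemma poly_xy_times_Im:
  "poly_xy F Fx Fy \<Longrightarrow> poly_xy (\<lambda>z. of_real (Im z) * F z) (\<lambda>z. of_real (Im z) * Fx z) (\<lambda>z. F z + of_real (Im z) * Fy z)"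
proof (induction rule: poly_xy.induct)
  case (poly_xy_monom i j)
  have "real (Suc j) * Re z ^ i * Im z ^ (Suc j - 1)
      = Re z ^ i * Im z ^ j + Im z * (real j * Re z ^ i * Im z ^ (j - 1))" for z
    by (cases j) (auto simp: algebra_simps)
  then have e: "complex_of_real (real (Suc j) * Re z ^ i * Im z ^ (Suc j - 1))
      = of_real (Re z ^ i * Im z ^ j) + of_real (Im z) * of_real (real j * Re z ^ i * Im z ^ (j - 1))" for z
    by (metis of_real_add of_real_mult)
  have e1: "complex_of_real (Re z ^ i * Im z ^ Suc j) = of_real (Im z) * of_real (Re z ^ i * Im z ^ j)"
    "complex_of_real (real i * Re z ^ (i - 1) * Im z ^ Suc j) = of_real (Im z) * of_real (real i * Re z ^ (i - 1) * Im z ^ j)" for z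
    by (simp_all add: mult_ac)
  show ?case using poly_xy.poly_xy_monom[of i "Suc j"] unfolding e e1 .
next
  case (poly_xy_scale F Fx Fy c)
  show ?case using poly_xy.poly_xy_scale[OF poly_xy_scale.IH, of c] by (simp add: algebra_simps)
next
  case (poly_xy_add F Fx Fy G Gx Gy)
  show ?case using poly_xy.poly_xy_add[OF poly_xy_add.IH] by (simp add: algebra_simps)
qed

lemma poly_xy_cong:
  "poly_xy F Fx Fy \<Longrightarrow> (\<And>z. F z = G z) \<Longrightarrow> (\<And>z. Fx z = Gx z) \<Longrightarrow> (\<And>z. Fy z = Gy z) \<Longrightarrow> poly_xy G Gx Gy"
  by (subgoal_tac "F = G \<and> Fx = Gx \<and> Fy = Gy") (auto intro: ext)

lemma poly_xy_times_z:
  assumes "poly_xy F Fx Fy"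
  shows "poly_xy (\<lambda>z. z * F z) (\<lambda>z. F z + z * Fx z) (\<lambda>z. \<i> * F z + z * Fy z)"
  by (rule poly_xy_cong[OF poly_xy_add[OF poly_xy_times_Re[OF assms] poly_xy_scale[OF poly_xy_times_Im[OF assms], of \<i>]]])
    (simp_all add: complex_eq_iff algebra_simps)

lemma poly_xy_times_cnj:
  assumes "poly_xy F Fx Fy"
  shows "poly_xy (\<lambda>z. cnj z * F z) (\<lambda>z. F z + cnj z * Fx z) (\<lambda>z. - \<i> * F z + cnj z * Fy z)"
  by (rule poly_xy_cong[OF poly_xy_add[OF poly_xy_times_Re[OF assms] poly_xy_scale[OF poly_xy_times_Im[OF assms], of "- \<i>"]]])
    (simp_all add: complex_eq_iff algebra_simps)

lemma poly_xy_cnj_poly: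
  "poly_xy (\<lambda>z. cnj (poly f z)) (\<lambda>z. cnj (poly (pderiv f) z)) (\<lambda>z. - \<i> * cnj (poly (pderiv f) z))"
proof (induction f)
  case 0
  show ?case using poly_xy_const[of 0] by simp
next
  case (pCons a f)
  show ?case
    by (rule poly_xy_cong[OF poly_xy_add[OF poly_xy_const[of "cnj a"] poly_xy_times_cnj[OF pCons.IH]]])
      (simp_all add: pderiv_pCons algebra_simps)
qed

lemma poly_xy_sesquilinear:
  "poly_xy (\<lambda>z. cnj (poly f z) * poly g z)
     (\<lambda>z. cnj (poly (pderiv f) z) * poly g z + cnj (poly f z) * poly (pderiv g) z)
     (\<lambda>z. - \<i> * cnj (poly (pderiv f) z) * poly g z + \<i> * cnj (poly f z) * poly (pderiv g) z)"
proof (induction g)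
  case 0
  show ?case using poly_xy_const[of 0] by simp
next
  case (pCons a g)
  show ?case
    by (rule poly_xy_cong[OF poly_xy_add[OF poly_xy_scale[OF poly_xy_cnj_poly[of f], of a] poly_xy_times_z[OF pCons.IH]]])
      (simp_all add: pderiv_pCons algebra_simps)
qed

lemma has_bochner_integral_eq_rhs:
  "has_bochner_integral M f x \<Longrightarrow> (\<And>z. f z = g z) \<Longrightarrow> x = y \<Longrightarrow> has_bochner_integral M g y"
  by (metis ext)

text \<open>Integration by parts against the Gaussian, once in each variable. Monomials factor by
  Fubini and reduce to \<open>gauss_moment_Suc\<close>. The values are existential so that
  integrability and the relation between the integrals pass through linear combinations
  together.\<close>

lemma poly_xy_gauss:
  fixes \<alpha> \<beta> :: real
  assumes "\<alpha> > 0" "\<beta> > 0" "poly_xy F Fx Fy"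
  defines "W \<equiv> (\<lambda>z. complex_of_real (exp (- (\<alpha> * (Re z)\<^sup>2 + \<beta> * (Im z)\<^sup>2))))"
  shows "\<exists>A I J. has_bochner_integral lborel (\<lambda>z. F z * W z) A \<and>
    has_bochner_integral lborel (\<lambda>z. Fx z * W z) (2 * of_real \<alpha> * I) \<and>
    has_bochner_integral lborel (\<lambda>z. of_real (Re z) * F z * W z) I \<and>
    has_bochner_integral lborel (\<lambda>z. Fy z * W z) (2 * of_real \<beta> * J) \<and>
    has_bochner_integral lborel (\<lambda>z. of_real (Im z) * F z * W z) J"
  using assms(3)
proof (induction rule: poly_xy.induct)
  case (poly_xy_monom i j)
  have w: "W z = of_real (exp (- (\<alpha> * (Re z)\<^sup>2)) * exp (- (\<beta> * (Im z)\<^sup>2)))" for z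
    unfolding W_def exp_add[symmetric] by simp
  have *: "has_bochner_integral lborel (\<lambda>z. of_real (Re z ^ i * Im z ^ j) * W z)
     (of_real (gauss_moment \<alpha> i * gauss_moment \<beta> j))" for i j
    unfolding w
    by (rule has_bochner_integral_eq_rhs[OF has_bochner_integral_Re_Im[OF has_integral_gauss_moment[OF assms(1), of i] has_integral_gauss_moment[OF assms(2), of j]]])
      simp_all
  have X: "has_bochner_integral lborel (\<lambda>z. of_real (real i * Re z ^ (i - 1) * Im z ^ j) * W z)
      (2 * of_real \<alpha> * of_real (gauss_moment \<alpha> (Suc i) * gauss_moment \<beta> j))"
  proof (rule has_bochner_integral_eq_rhs[OF has_bochner_integral_mult_right[OF *[of "i - 1" j], of "of_real (real i)"]])
    have "2 * complex_of_real \<alpha> * of_real (gauss_moment \<alpha> (Suc i) * gauss_moment \<beta> j)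
      = of_real ((2 * \<alpha> * gauss_moment \<alpha> (Suc i)) * gauss_moment \<beta> j)" by simp
    also have "\<dots> = of_real (real i) * of_real (gauss_moment \<alpha> (i - 1) * gauss_moment \<beta> j)"
      unfolding gauss_moment_Suc[OF assms(1)] by simp
    finally show "of_real (real i) * of_real (gauss_moment \<alpha> (i - 1) * gauss_moment \<beta> j)
      = 2 * complex_of_real \<alpha> * of_real (gauss_moment \<alpha> (Suc i) * gauss_moment \<beta> j)" by (rule sym)
  qed simp
  have Y: "has_bochner_integral lborel (\<lambda>z. of_real (real j * Re z ^ i * Im z ^ (j - 1)) * W z)
      (2 * of_real \<beta> * of_real (gauss_moment \<alpha> i * gauss_moment \<beta> (Suc j)))"
  proof (rule has_bochner_integral_eq_rhs[OF has_bochner_integral_mult_right[OF *[of i "j - 1"], of "of_real (real j)"]])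
    have "2 * complex_of_real \<beta> * of_real (gauss_moment \<alpha> i * gauss_moment \<beta> (Suc j))
      = of_real (gauss_moment \<alpha> i * (2 * \<beta> * gauss_moment \<beta> (Suc j)))" by simp
    also have "\<dots> = of_real (real j) * of_real (gauss_moment \<alpha> i * gauss_moment \<beta> (j - 1))"
      unfolding gauss_moment_Suc[OF assms(2)] by simp
    finally show "of_real (real j) * of_real (gauss_moment \<alpha> i * gauss_moment \<beta> (j - 1))
      = 2 * complex_of_real \<beta> * of_real (gauss_moment \<alpha> i * gauss_moment \<beta> (Suc j))" by (rule sym)
  qed simp
  have X': "has_bochner_integral lborel (\<lambda>z. of_real (Re z) * of_real (Re z ^ i * Im z ^ j) * W z)
     (of_real (gauss_moment \<alpha> (Suc i) * gauss_moment \<beta> j))"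
    by (rule has_bochner_integral_eq_rhs[OF *[of "Suc i" j]]) simp_all
  have Y': "has_bochner_integral lborel (\<lambda>z. of_real (Im z) * of_real (Re z ^ i * Im z ^ j) * W z)
     (of_real (gauss_moment \<alpha> i * gauss_moment \<beta> (Suc j)))"
    by (rule has_bochner_integral_eq_rhs[OF *[of i "Suc j"]]) simp_all
  show ?case by (intro exI conjI, fact *, fact X, fact X', fact Y, fact Y')
next
  case (poly_xy_scale F Fx Fy c)
  from poly_xy_scale.IH obtain A I J where
    "has_bochner_integral lborel (\<lambda>z. F z * W z) A"
    "has_bochner_integral lborel (\<lambda>z. Fx z * W z) (2 * of_real \<alpha> * I)"
    "has_bochner_integral lborel (\<lambda>z. of_real (Re z) * F z * W z) I"
    "has_bochner_integral lborel (\<lambda>z. Fy z * W z) (2 * of_real \<beta> * J)"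
    "has_bochner_integral lborel (\<lambda>z. of_real (Im z) * F z * W z) J" by blast
  note * = this[THEN has_bochner_integral_mult_right, of c]
  show ?case
  proof (rule exI[of _ "c * A"], rule exI[of _ "c * I"], rule exI[of _ "c * J"], intro conjI)
    show "has_bochner_integral lborel (\<lambda>z. c * F z * W z) (c * A)"
      by (rule has_bochner_integral_eq_rhs[OF *(1)]) (simp_all add: mult.assoc)
    show "has_bochner_integral lborel (\<lambda>z. c * Fx z * W z) (2 * of_real \<alpha> * (c * I))"
      by (rule has_bochner_integral_eq_rhs[OF *(2)]) (simp_all add: mult.assoc)
    show "has_bochner_integral lborel (\<lambda>z. of_real (Re z) * (c * F z) * W z) (c * I)"
      by (rule has_bochner_integral_eq_rhs[OF *(3)]) (simp_all add: mult.assoc mult.left_commute)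
    show "has_bochner_integral lborel (\<lambda>z. c * Fy z * W z) (2 * of_real \<beta> * (c * J))"
      by (rule has_bochner_integral_eq_rhs[OF *(4)]) (simp_all add: mult.assoc)
    show "has_bochner_integral lborel (\<lambda>z. of_real (Im z) * (c * F z) * W z) (c * J)"
      by (rule has_bochner_integral_eq_rhs[OF *(5)]) (simp_all add: mult.assoc mult.left_commute)
  qed
next
  case (poly_xy_add F Fx Fy G Gx Gy)
  from poly_xy_add.IH(1) obtain A I J where F:
    "has_bochner_integral lborel (\<lambda>z. F z * W z) A"
    "has_bochner_integral lborel (\<lambda>z. Fx z * W z) (2 * of_real \<alpha> * I)"
    "has_bochner_integral lborel (\<lambda>z. of_real (Re z) * F z * W z) I"
    "has_bochner_integral lborel (\<lambda>z. Fy z * W z) (2 * of_real \<beta> * J)"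
    "has_bochner_integral lborel (\<lambda>z. of_real (Im z) * F z * W z) J" by blast
  from poly_xy_add.IH(2) obtain A' I' J' where G:
    "has_bochner_integral lborel (\<lambda>z. G z * W z) A'"
    "has_bochner_integral lborel (\<lambda>z. Gx z * W z) (2 * of_real \<alpha> * I')"
    "has_bochner_integral lborel (\<lambda>z. of_real (Re z) * G z * W z) I'"
    "has_bochner_integral lborel (\<lambda>z. Gy z * W z) (2 * of_real \<beta> * J')"
    "has_bochner_integral lborel (\<lambda>z. of_real (Im z) * G z * W z) J'" by blast
  note * = F[THEN has_bochner_integral_add]
  show ?case
  proof (rule exI[of _ "A + A'"], rule exI[of _ "I + I'"], rule exI[of _ "J + J'"], intro conjI)
    show "has_bochner_integral lborel (\<lambda>z. (F z + G z) * W z) (A + A')"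
      by (rule has_bochner_integral_eq_rhs[OF *(1)[OF G(1)]]) (simp_all add: ring_distribs)
    show "has_bochner_integral lborel (\<lambda>z. (Fx z + Gx z) * W z) (2 * of_real \<alpha> * (I + I'))"
      by (rule has_bochner_integral_eq_rhs[OF *(2)[OF G(2)]]) (simp_all add: ring_distribs)
    show "has_bochner_integral lborel (\<lambda>z. of_real (Re z) * (F z + G z) * W z) (I + I')"
      by (rule has_bochner_integral_eq_rhs[OF *(3)[OF G(3)]]) (simp_all add: ring_distribs)
    show "has_bochner_integral lborel (\<lambda>z. (Fy z + Gy z) * W z) (2 * of_real \<beta> * (J + J'))"
      by (rule has_bochner_integral_eq_rhs[OF *(4)[OF G(4)]]) (simp_all add: ring_distribs)
    show "has_bochner_integral lborel (\<lambda>z. of_real (Im z) * (F z + G z) * W z) (J + J')"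
      by (rule has_bochner_integral_eq_rhs[OF *(5)[OF G(5)]]) (simp_all add: ring_distribs)
  qed
qed

subsection \<open>Orthogonal polynomials for the elliptic potential\<close>

locale elliptic_weight =
  fixes t \<nu> :: real
  assumes t_pos: "0 < t" and t_less: "t < 1" and nu_pos: "0 < \<nu>"
begin

definition weight :: "complex \<Rightarrow> complex" where
  "weight z = of_real (exp (- (\<nu> * elliptic_potential t z)))"

definition ip :: "complex poly \<Rightarrow> complex poly \<Rightarrow> complex" where
  "ip f g = (LBINT z. cnj (poly f z) * poly g z * weight z)"

text \<open>Each application of \<open>raise\<close> multiplies the leading coefficient by this
  constant. The factor \<open>1 - t\<^sup>2\<close> appears when the two real integrations by parts
  are combined into one involving only multiplication by z.\<close>

definition lam :: real where "lam = \<nu> * (1 - t\<^sup>2)"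

lemma lam_pos: "lam > 0"
  using t_pos t_less nu_pos by (simp add: lam_def abs_square_less_1)

lemma weight_eq: "weight z = of_real (exp (- (\<nu> * (1 - t) * (Re z)\<^sup>2 + \<nu> * (1 + t) * (Im z)\<^sup>2)))"
  unfolding weight_def elliptic_potential_def cmod_power2
  by (simp add: algebra_simps power2_eq_square)

lemma has_ip: "has_bochner_integral lborel (\<lambda>z. cnj (poly f z) * poly g z * weight z) (ip f g)"
  using poly_xy_gauss[OF _ _ poly_xy_sesquilinear[of f g], of "\<nu> * (1 - t)" "\<nu> * (1 + t)"] t_pos t_less nu_pos
  by (auto simp: ip_def weight_eq has_bochner_integral_iff)

lemma ip_eqI: "has_bochner_integral lborel (\<lambda>z. cnj (poly f z) * poly g z * weight z) I \<Longrightarrow> ip f g = I"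
  by (simp add: ip_def has_bochner_integral_iff)

lemma ip_cnj: "ip g f = cnj (ip f g)"
  by (rule ip_eqI, rule has_bochner_integral_eq_rhs[OF has_bochner_integral_cnj[OF has_ip[of f g]]])
    (simp_all add: weight_def)

lemma ip_add_right: "ip f (g + h) = ip f g + ip f h"
  by (rule ip_eqI, rule has_bochner_integral_eq_rhs[OF has_bochner_integral_add[OF has_ip[of f g] has_ip[of f h]]])
    (simp_all add: algebra_simps)

lemma ip_smult_right: "ip f (smult c g) = c * ip f g"
  by (rule ip_eqI, rule has_bochner_integral_eq_rhs[OF has_bochner_integral_mult_right[OF has_ip[of f g], of c]])
    (simp_all add: algebra_simps)

lemma ip_diff_right: "ip f (g - h) = ip f g - ip f h"
  using ip_add_right[of f g "smult (-1) h"] ip_smult_right[of f "-1" h] by simp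

lemma ip_smult_left: "ip (smult c f) g = cnj c * ip f g"
  by (metis ip_cnj ip_smult_right complex_cnj_mult)

lemma ip_add_left: "ip (f + g) h = ip f h + ip g h"
  by (metis ip_cnj ip_add_right complex_cnj_add)

lemma ip_0_left [simp]: "ip 0 g = 0"
  by (simp add: ip_def)

text \<open>Here \<open>poly_xy_gauss\<close> is applied to the product of an antiholomorphic and a
  holomorphic polynomial. \<open>I\<close> and \<open>J\<close> are its moments against
  \<open>Re z\<close> and \<open>Im z\<close>, which recombine into multiplication by z or by its
  conjugate.\<close>

lemma ip_pderiv_sum:
  "\<exists>I J. ip (pderiv f) g + ip f (pderiv g) = 2 * of_real (\<nu> * (1 - t)) * I \<and>
         - \<i> * ip (pderiv f) g + \<i> * ip f (pderiv g) = 2 * of_real (\<nu> * (1 + t)) * J \<and>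
         ip f (pCons 0 g) = I + \<i> * J \<and> ip (pCons 0 f) g = I - \<i> * J"
proof -
  have pos: "\<nu> * (1 - t) > 0" "\<nu> * (1 + t) > 0" using t_pos t_less nu_pos by auto
  obtain I J where I:
    "has_bochner_integral lborel (\<lambda>z. (cnj (poly (pderiv f) z) * poly g z + cnj (poly f z) * poly (pderiv g) z) * weight z)
      (2 * of_real (\<nu> * (1 - t)) * I)"
    "has_bochner_integral lborel (\<lambda>z. of_real (Re z) * (cnj (poly f z) * poly g z) * weight z) I"
    and J: "has_bochner_integral lborel (\<lambda>z. (- \<i> * cnj (poly (pderiv f) z) * poly g z + \<i> * cnj (poly f z) * poly (pderiv g) z) * weight z)
      (2 * of_real (\<nu> * (1 + t)) * J)"
    "has_bochner_integral lborel (\<lambda>z. of_real (Im z) * (cnj (poly f z) * poly g z) * weight z) J"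
    using poly_xy_gauss[OF pos poly_xy_sesquilinear[of f g]] unfolding weight_eq by blast
  show ?thesis
  proof (intro exI conjI)
    show "ip (pderiv f) g + ip f (pderiv g) = 2 * of_real (\<nu> * (1 - t)) * I"
      by (rule has_bochner_integral_eq[OF has_bochner_integral_eq_rhs[OF
          has_bochner_integral_add[OF has_ip[of "pderiv f" g] has_ip[of f "pderiv g"]] _ refl] I(1)])
        (simp add: algebra_simps)
    show "- \<i> * ip (pderiv f) g + \<i> * ip f (pderiv g) = 2 * of_real (\<nu> * (1 + t)) * J"
      by (rule has_bochner_integral_eq[OF has_bochner_integral_eq_rhs[OF
          has_bochner_integral_add[OF has_bochner_integral_mult_right[OF has_ip[of "pderiv f" g], of "- \<i>"]
             has_bochner_integral_mult_right[OF has_ip[of f "pderiv g"], of \<i>]] _ refl] J(1)])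
        (simp add: algebra_simps)
    have z: "of_real (Re z) * w + \<i> * (of_real (Im z) * w) = z * w"
        "of_real (Re z) * w - \<i> * (of_real (Im z) * w) = cnj z * w" for z w
      by (simp_all add: complex_eq_iff algebra_simps)
    show "ip f (pCons 0 g) = I + \<i> * J"
      by (rule ip_eqI, rule has_bochner_integral_eq_rhs[OF has_bochner_integral_add[OF I(2)
          has_bochner_integral_mult_right[OF J(2), of \<i>]] _ refl])
        (simp only: mult.assoc z, simp add: algebra_simps)
    show "ip (pCons 0 f) g = I - \<i> * J"
      by (rule ip_eqI, rule has_bochner_integral_eq_rhs[OF has_bochner_integral_diff[OF I(2)
          has_bochner_integral_mult_right[OF J(2), of \<i>]] _ refl])
        (simp only: mult.assoc z, simp add: algebra_simps)
  qed
qed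

text \<open>The adjoint of differentiation for \<open>ip\<close>. Since the weight \<open>W\<close> satisfies
  \<open>\<partial>W/\<partial>cnj z = - \<nu> (z - t cnj z) W\<close>, iterating it on \<open>1\<close> produces the orthogonal polynomials.\<close>

definition raise :: "complex poly \<Rightarrow> complex poly" where
  "raise g = smult (of_real lam) (pCons 0 g) - smult (of_real t) (pderiv g)"

lemma ip_raise: "ip f (raise g) = ip (pderiv f) g"
proof -
  obtain I J where *: "ip (pderiv f) g + ip f (pderiv g) = 2 * of_real (\<nu> * (1 - t)) * I"
         "- \<i> * ip (pderiv f) g + \<i> * ip f (pderiv g) = 2 * of_real (\<nu> * (1 + t)) * J"
         "ip f (pCons 0 g) = I + \<i> * J"
    using ip_pderiv_sum by blast
  define P Q where "P = ip (pderiv f) g" and "Q = ip f (pderiv g)"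
  define N T where "N = complex_of_real \<nu>" and "T = complex_of_real t"
  have 1: "P + Q = 2 * (N * (1 - T)) * I" using *(1) by (simp add: P_def Q_def N_def T_def)
  have "\<i> * (- \<i> * P + \<i> * Q) = \<i> * (2 * (N * (1 + T)) * J)" using *(2) by (simp add: P_def Q_def N_def T_def)
  then have 2: "P - Q = 2 * (N * (1 + T)) * (\<i> * J)" by (simp add: algebra_simps)
  \<comment> \<open>The weights \<open>1 + T\<close> and \<open>1 - T\<close> give \<open>I\<close>
    and \<open>\<i> * J\<close> the same coefficient, so that they combine into the moment against
    z. The term \<open>T * Q\<close> left over is what the subtracted derivative in
    \<open>raise\<close> removes.\<close>
  have "2 * (N * (1 - T\<^sup>2) * (I + \<i> * J)) = (1 + T) * (P + Q) + (1 - T) * (P - Q)"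
    unfolding 1 2 by (simp add: algebra_simps power2_eq_square)
  also have "\<dots> = 2 * (P + T * Q)" by (simp add: algebra_simps)
  finally have "N * (1 - T\<^sup>2) * (I + \<i> * J) = P + T * Q" by (simp only: mult_cancel_left) simp
  then show ?thesis
    unfolding raise_def ip_diff_right ip_smult_right *(3)
    by (simp add: lam_def P_def Q_def N_def T_def)
qed

definition herm :: "nat \<Rightarrow> complex poly" where
  "herm k = (raise ^^ k) 1"

lemma herm_0 [simp]: "herm 0 = 1" and herm_Suc: "herm (Suc k) = raise (herm k)"
  by (simp_all add: herm_def)

lemma ip_herm: "ip f (herm k) = ip ((pderiv ^^ k) f) 1"
  by (induction k arbitrary: f) (simp_all add: herm_Suc ip_raise funpow_swap1)

lemma degree_lead_herm: "degree (herm k) = k \<and> lead_coeff (herm k) = of_real (lam ^ k)"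
proof (induction k)
  case (Suc k)
  define g where "g = herm k"
  have g: "degree g = k" "coeff g k = of_real (lam ^ k)" using Suc by (auto simp: g_def)
  have "g \<noteq> 0" using g lam_pos by auto
  have le: "degree (raise g) \<le> Suc k"
    unfolding raise_def using g(1)
    by (intro degree_diff_le order.trans[OF degree_smult_le]) (auto simp: degree_pCons_eq_if degree_pderiv)
  have "coeff (pderiv g) (Suc k) = 0"
    by (rule coeff_eq_0) (simp add: degree_pderiv g)
  then have c: "coeff (raise g) (Suc k) = of_real (lam ^ Suc k)"
    by (simp add: raise_def g)
  then have "degree (raise g) = Suc k" using le lam_pos
    by (metis le_antisym le_degree of_real_eq_0_iff power_not_zero less_irrefl)
  then show ?case using c by (simp add: herm_Suc g_def)
qed simp

lemmas degree_herm [simp] = degree_lead_herm[THEN conjunct1]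
lemma coeff_herm: "coeff (herm k) k = of_real (lam ^ k)"
  using degree_lead_herm[of k] by simp

lemma funpow_pderiv_degree:
  fixes f :: "complex poly"
  shows "degree f \<le> k \<Longrightarrow> (pderiv ^^ k) f = [: fact k * coeff f k :]"
proof (induction k arbitrary: f)
  case 0
  then show ?case by (simp add: degree_0_id)
next
  case (Suc k)
  have "degree (pderiv f) \<le> k" using Suc.prems by (simp add: degree_pderiv)
  from Suc.IH[OF this] show ?case
    by (simp add: funpow_swap1 coeff_pderiv algebra_simps)
qed

definition total_mass :: real where "total_mass = pi / (\<nu> * sqrt (1 - t\<^sup>2))"

lemma total_mass_pos: "total_mass > 0"
  using t_pos t_less nu_pos by (simp add: total_mass_def abs_square_less_1)

lemma ip_1_1: "ip 1 1 = of_real total_mass"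
proof (rule ip_eqI)
  have pos: "\<nu> * (1 - t) > 0" "\<nu> * (1 + t) > 0" using t_pos t_less nu_pos by auto
  show "has_bochner_integral lborel (\<lambda>z. cnj (poly 1 z) * poly 1 z * weight z) (of_real total_mass)"
  proof (rule has_bochner_integral_eq_rhs[OF has_bochner_integral_Re_Im[OF has_integral_gauss_moment[OF pos(1), of 0] has_integral_gauss_moment[OF pos(2), of 0]]])
    have "sqrt (pi / (\<nu> * (1 - t))) * sqrt (pi / (\<nu> * (1 + t))) = sqrt ((pi / \<nu>)\<^sup>2 / (1 - t\<^sup>2))"
      by (simp add: real_sqrt_mult[symmetric] power2_eq_square algebra_simps)
    also have "\<dots> = total_mass" using nu_pos by (simp add: real_sqrt_divide total_mass_def)
    finally show "complex_of_real (gauss_moment (\<nu> * (1 - t)) 0 * gauss_moment (\<nu> * (1 + t)) 0) = of_real total_mass"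
      by (simp add: gauss_moment_0 pos)
  qed (simp add: weight_eq exp_add[symmetric])
qed

text \<open>The square of the norm of \<open>herm k\<close>, hence the square root in
  \<open>onp\<close>.\<close>

definition hnorm :: "nat \<Rightarrow> real" where
  "hnorm k = fact k * lam ^ k * total_mass"

lemma hnorm_pos: "hnorm k > 0"
  using lam_pos total_mass_pos by (simp add: hnorm_def)

lemma ip_const: "ip [:c:] 1 = cnj c * of_real total_mass"
  using ip_smult_left[of c 1 1] by (simp add: ip_1_1)

text \<open>Moving all k raising operators to the other side differentiates \<open>f\<close> k
  times, which leaves only its coefficient of index k. Degrees below k give orthogonality, degree k
  gives the norm.\<close>

lemma ip_herm_eq: "degree f \<le> k \<Longrightarrow> ip f (herm k) = cnj (fact k * coeff f k) * of_real total_mass"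
  by (simp only: ip_herm funpow_pderiv_degree ip_const)

lemma ip_herm_herm: "ip (herm j) (herm k) = (if j = k then of_real (hnorm k) else 0)"
proof -
  have le: "ip (herm j) (herm k) = (if j = k then of_real (hnorm k) else 0)" if "j \<le> k" for j k
    using that by (auto simp: ip_herm_eq coeff_herm hnorm_def coeff_eq_0)
  show ?thesis
  proof (cases "j \<le> k")
    case False
    then have "ip (herm k) (herm j) = 0" using le[of k j] by simp
    then show ?thesis using False ip_cnj[of "herm j" "herm k"] by auto
  qed (rule le)
qed

definition onp :: "nat \<Rightarrow> complex poly" where
  "onp k = smult (of_real (1 / sqrt (hnorm k))) (herm k)"

lemma degree_onp [simp]: "degree (onp k) = k"
  using hnorm_pos[of k] by (simp add: onp_def)

lemma coeff_onp: "coeff (onp k) k = of_real (lam ^ k / sqrt (hnorm k))"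
  by (simp add: onp_def coeff_herm)

lemma ip_onp: "ip (onp j) (onp k) = (if j = k then 1 else 0)"
  using hnorm_pos[of k]
  by (auto simp: onp_def ip_smult_left ip_smult_right ip_herm_herm divide_simps of_real_mult[symmetric] simp del: of_real_mult)

end

section \<open>Uniqueness of the orthonormal family\<close>

text \<open>A family with one polynomial of each degree spans: coefficients are eliminated from the
  top down. The alternative \<open>f = 0\<close> is listed separately because the zero polynomial
  has degree 0 and would be missed for \<open>n = 0\<close>.\<close>

lemma poly_span_induct:
  fixes p :: "nat \<Rightarrow> complex poly"
  assumes deg: "\<And>k. degree (p k) = k" "\<And>k. lead_coeff (p k) \<noteq> 0"
    and 0: "P 0" and step: "\<And>f c k. P f \<Longrightarrow> k < n \<Longrightarrow> P (f + smult c (p k))"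
  shows "f = 0 \<or> degree f < n \<Longrightarrow> P f"
proof -
  have "k \<le> n \<Longrightarrow> (\<forall>i\<ge>k. coeff f i = 0) \<Longrightarrow> P f" for k f
  proof (induction k arbitrary: f)
    case 0
    then have "f = 0" by (intro poly_eqI) auto
    then show ?case using \<open>P 0\<close> by simp
  next
    case (Suc k)
    define c where "c = coeff f k / lead_coeff (p k)"
    have "P (f - smult c (p k))"
    proof (rule Suc.IH)
      show "\<forall>i\<ge>k. coeff (f - smult c (p k)) i = 0"
      proof (intro allI impI)
        fix i assume "i \<ge> k"
        show "coeff (f - smult c (p k)) i = 0"
        proof (cases "i = k")
          case True
          then show ?thesis using deg(1)[of k] deg(2)[of k] by (simp add: c_def)
        next
          case False
          then have "i > k" using \<open>i \<ge> k\<close> by simp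
          then show ?thesis using Suc.prems deg(1)[of k] by (simp add: coeff_eq_0)
        qed
      qed
    qed (use Suc.prems in simp)
    from step[OF this, of k c] show ?case using Suc.prems by simp
  qed
  from this[of n f] show "f = 0 \<or> degree f < n \<Longrightarrow> P f" by (auto simp: coeff_eq_0)
qed

context elliptic_weight begin

text \<open>Both \<open>p k\<close> and \<open>onp k\<close> are orthogonal to everything of lower
  degree. Matching the leading coefficients leaves a difference of lower degree that is orthogonal
  to all lower degrees, hence zero; unit norm and positivity then fix the scalar.\<close>

lemma ortho_unique:
  assumes "\<And>k. degree (p k) = k \<and> lead_coeff (p k) \<in> \<real> \<and> 0 < Re (lead_coeff (p k))"
    and "\<And>k l. ip (p k) (p l) = (if k = l then 1 else 0)"
  shows "p = onp"
proof
  fix k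
  have deg: "degree (p j) = j" "lead_coeff (p j) \<noteq> 0" for j using assms(1)[of j] by (auto simp del: leading_coeff_0_iff)
  have low_p: "ip f (p k) = 0" if "f = 0 \<or> degree f < k" for f
    by (rule poly_span_induct[of p "\<lambda>f. ip f (p k) = 0" k, OF deg _ _ that])
      (auto simp: ip_add_left ip_smult_left assms(2))
  have low: "ip f (onp k) = 0" if "f = 0 \<or> degree f < k" for f
    using that by (auto simp: onp_def ip_smult_right ip_herm_eq coeff_eq_0)
  define a where "a = Re (lead_coeff (p k))"
  have a: "coeff (p k) k = of_real a" "a > 0"
    using assms(1)[of k] by (auto simp: a_def complex_is_Real_iff complex_eq_iff)
  \<comment> \<open>The ratio of the leading coefficients of \<open>p k\<close> and
    \<open>onp k\<close>.\<close>
  define c where "c = a * sqrt (hnorm k) / lam ^ k"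
  have c: "c > 0" using a lam_pos hnorm_pos[of k] by (simp add: c_def)
  define d where "d = p k - smult (of_real c) (onp k)"
  have dk: "coeff d i = 0" if "i \<ge> k" for i
  proof (cases "i = k")
    case True
    then show ?thesis using lam_pos hnorm_pos[of k]
      by (simp add: d_def a coeff_onp c_def)
  next
    case False
    then show ?thesis using that deg(1)[of k] by (simp add: d_def coeff_eq_0)
  qed
  have "d = 0"
  proof (rule ccontr)
    assume "d \<noteq> 0"
    then have j: "degree d < k" using dk[of "degree d"] by (meson leading_coeff_0_iff not_le)
    \<comment> \<open>Pairing \<open>d\<close> with the Hermite polynomial of the same degree reads
      off its leading coefficient; this takes the place of positive definiteness of
      \<open>ip\<close>.\<close>
    have "ip (herm (degree d)) d = 0"
      using j low_p[of "herm (degree d)"] low[of "herm (degree d)"]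
      by (simp add: d_def ip_diff_right ip_smult_right)
    then have "ip d (herm (degree d)) = 0" using ip_cnj[of d "herm (degree d)"] by simp
    then show False using \<open>d \<noteq> 0\<close> total_mass_pos by (simp add: ip_herm_eq)
  qed
  then have pk: "p k = smult (of_real c) (onp k)" by (simp add: d_def)
  have "of_real (c * c) = (1::complex)"
    using assms(2)[of k k] unfolding pk ip_smult_left ip_smult_right ip_onp by simp
  then have "c * c = 1" by (simp only: of_real_eq_1_iff)
  then have "c = 1" using c by (simp add: square_eq_1_iff)
  then show "p k = onp k" using pk by simp
qed

lemma cmod_poly_onp: "(cmod (poly (onp k) z))\<^sup>2 = (cmod (poly (herm k) z))\<^sup>2 / hnorm k"
  using hnorm_pos[of k] by (simp add: onp_def norm_mult power_mult_distrib power_divide norm_divide)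

end

lemma orthonormal_poly_elliptic:
  assumes "0 < t" "t < 1" "n > 0"
  shows "orthonormal_poly (elliptic_potential t) n = elliptic_weight.onp t (real n)"
proof -
  interpret elliptic_weight t "real n" using assms by unfold_locales auto
  show ?thesis unfolding orthonormal_poly_def
  proof (rule the_equality)
    show "orthonormal_polys (elliptic_potential t) n onp"
      unfolding orthonormal_polys_def
      using has_ip[of "onp _" "onp _"] lam_pos hnorm_pos by (simp add: ip_onp coeff_onp weight_def)
    fix p assume p: "orthonormal_polys (elliptic_potential t) n p"
    show "p = onp"
    proof (rule ortho_unique)
      show "ip (p k) (p l) = (if k = l then 1 else 0)" for k l
        using p unfolding orthonormal_polys_def by (intro ip_eqI) (simp add: weight_def)
    qed (use p[unfolded orthonormal_polys_def] in blast)
  qed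
qed

subsection \<open>Mehler's formula\<close>

text \<open>Mehler's kernel for Hermite polynomials scaled by \<open>L\<close> and \<open>T\<close>.
  The principal square root is holomorphic where it is needed, since
  \<open>1 - T\<^sup>2 * s\<^sup>2\<close> has positive real part for |T s| < 1.\<close>

definition mehler :: "complex \<Rightarrow> complex \<Rightarrow> complex \<Rightarrow> complex \<Rightarrow> complex \<Rightarrow> complex" where
  "mehler L T z w s =
     exp (L * (s * z * w - s\<^sup>2 * T / 2 * (z\<^sup>2 + w\<^sup>2)) / (1 - T\<^sup>2 * s\<^sup>2)) / csqrt (1 - T\<^sup>2 * s\<^sup>2)"

lemma one_minus_square_notin_nonpos_Reals:
  fixes x :: complex
  assumes "norm x < 1" shows "1 - x\<^sup>2 \<notin> \<real>\<^sub>\<le>\<^sub>0"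
proof
  assume "1 - x\<^sup>2 \<in> \<real>\<^sub>\<le>\<^sub>0"
  then have "Re (1 - x\<^sup>2) \<le> 0" by (auto simp: complex_nonpos_Reals_iff)
  then have "1 \<le> norm (x\<^sup>2)" using complex_Re_le_cmod[of "x\<^sup>2"] by simp
  moreover have "(norm x)\<^sup>2 < 1" using assms by (simp add: abs_square_less_1)
  ultimately show False by (simp add: norm_power)
qed

text \<open>The point is that the logarithmic derivative is a rational function of s, so that the
  kernel satisfies a first-order linear equation which makes sense for formal power series.\<close>

lemma mehler_deriv:
  assumes "norm (T * s) < 1"
  shows "(mehler L T z w has_field_derivative
     mehler L T z w s * (L * (z - T * s * w) * (w - T * s * z) / (1 - T\<^sup>2 * s\<^sup>2)\<^sup>2 + T\<^sup>2 * s / (1 - T\<^sup>2 * s\<^sup>2))) (at s)"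
proof -
  define D where "D s = 1 - T\<^sup>2 * s\<^sup>2" for s
  define P where "P s = s * z * w - s\<^sup>2 * T / 2 * (z\<^sup>2 + w\<^sup>2)" for s
  have nonpos: "D s \<notin> \<real>\<^sub>\<le>\<^sub>0"
    using one_minus_square_notin_nonpos_Reals[OF assms] by (simp add: D_def power_mult_distrib)
  then have D0: "D s \<noteq> 0" by auto
  have dD: "(D has_field_derivative - 2 * T\<^sup>2 * s) (at s)"
    unfolding D_def by (auto intro!: derivative_eq_intros)
  have dP: "(P has_field_derivative (z * w - s * T * (z\<^sup>2 + w\<^sup>2))) (at s)"
    unfolding P_def by (auto intro!: derivative_eq_intros)
  have dE: "((\<lambda>s. L * P s / D s) has_field_derivative L * (z - T * s * w) * (w - T * s * z) / (D s)\<^sup>2) (at s)"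
  proof (rule DERIV_cong[OF DERIV_divide[OF DERIV_cmult[OF dP] dD D0]])
    show "(L * (z * w - s * T * (z\<^sup>2 + w\<^sup>2)) * D s - L * P s * (- 2 * T\<^sup>2 * s)) / (D s * D s)
       = L * (z - T * s * w) * (w - T * s * z) / (D s)\<^sup>2"
      unfolding power2_eq_square[of "D s"]
      by (rule arg_cong[of _ _ "\<lambda>x. x / (D s * D s)"])
        (simp add: P_def D_def power2_eq_square, simp add: algebra_simps)
  qed
  have dR: "((\<lambda>s. csqrt (D s)) has_field_derivative - 2 * T\<^sup>2 * s / (2 * csqrt (D s))) (at s)"
    using has_field_derivative_csqrt'[OF dD nonpos] by (simp add: field_simps)
  have sq: "csqrt (D s) * csqrt (D s) = D s" using power2_csqrt[of "D s"] by (simp add: power2_eq_square)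
  have C0: "csqrt (D s) \<noteq> 0" using D0 by simp
  have "((\<lambda>s. exp (L * P s / D s) / csqrt (D s)) has_field_derivative
     exp (L * P s / D s) / csqrt (D s) * (L * (z - T * s * w) * (w - T * s * z) / (D s)\<^sup>2 + T\<^sup>2 * s / D s)) (at s)"
  proof (rule DERIV_cong[OF DERIV_divide[OF DERIV_chain2[OF DERIV_exp dE] dR C0]])
    define X where "X = L * (z - T * s * w) * (w - T * s * z) / (D s)\<^sup>2"
    define R where "R = csqrt (D s)"
    have DR: "D s = R * R" and R0: "R \<noteq> 0" using sq C0 by (auto simp: R_def)
    show "(exp (L * P s / D s) * (L * (z - T * s * w) * (w - T * s * z) / (D s)\<^sup>2) * csqrt (D s) -
          exp (L * P s / D s) * (- 2 * T\<^sup>2 * s / (2 * csqrt (D s)))) / (csqrt (D s) * csqrt (D s))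
      = exp (L * P s / D s) / csqrt (D s) * (L * (z - T * s * w) * (w - T * s * z) / (D s)\<^sup>2 + T\<^sup>2 * s / D s)"
      unfolding X_def[symmetric] R_def[symmetric] unfolding DR using R0 by (simp add: divide_simps) (simp add: algebra_simps)
  qed
  then show ?thesis by (simp add: mehler_def[abs_def] D_def P_def)
qed

lemma mehler_holomorphic: "mehler L T z w holomorphic_on {s. norm (T * s) < 1}"
  unfolding holomorphic_on_def field_differentiable_def
  using mehler_deriv has_field_derivative_at_within by blast

text \<open>Both series have logarithmic derivative N / D, so their quotient has derivative zero.
  The equations are stated with the denominator cleared; series over a field form an integral
  domain, so a nonzero \<open>D\<close> can be cancelled.\<close>

lemma fps_log_deriv_unique:
  fixes A F N D :: "complex fps"
  assumes "fps_deriv A * D = A * N" "fps_deriv F * D = F * N" "D \<noteq> 0" "F $ 0 \<noteq> 0" "A $ 0 = F $ 0"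
  shows "A = F"
proof -
  have "D * (fps_deriv A * F - A * fps_deriv F) = (fps_deriv A * D) * F - A * (fps_deriv F * D)"
    by (simp add: algebra_simps)
  also have "\<dots> = 0" unfolding assms(1,2) by (simp add: algebra_simps)
  finally have eq: "fps_deriv A * F - A * fps_deriv F = 0" using assms(3) by simp
  define I where "I = inverse F"
  have FI: "F * I = 1" using assms(4) by (simp add: I_def inverse_mult_eq_1')
  have "fps_deriv (A * I) = fps_deriv A * (F * I) * I - A * (fps_deriv F * I\<^sup>2)"
    unfolding FI by (simp add: I_def fps_inverse_deriv assms(4) algebra_simps)
  also have "\<dots> = (fps_deriv A * F - A * fps_deriv F) * I\<^sup>2"
    by (simp add: algebra_simps power2_eq_square)
  finally have "fps_deriv (A * I) = 0" unfolding eq by simp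
  then have "A * I = fps_const ((A * I) $ 0)" unfolding fps_deriv_eq_0_iff .
  also have "(A * I) $ 0 = 1" using assms(4,5) by (simp add: I_def)
  finally have "A * I = 1" by simp
  then have "A * (F * I) = F" by (metis mult.assoc mult.commute mult_1)
  then show ?thesis by (simp add: FI)
qed

lemma hermite_product_fps_ode:
  fixes u v :: "nat \<Rightarrow> complex" and L T z w :: complex
  assumes L: "L \<noteq> 0"
    and u: "\<And>k. u (Suc k) = L * z * u k - T * L * of_nat k * u (k - 1)"
    and v: "\<And>k. v (Suc k) = L * w * v k - T * L * of_nat k * v (k - 1)"
  defines "A \<equiv> Abs_fps (\<lambda>k. u k * v k / (fact k * L ^ k))"
    and "D \<equiv> 1 - fps_const (T\<^sup>2) * fps_X\<^sup>2"
  shows "fps_deriv A * D\<^sup>2 = A * (fps_const L * (fps_const z - fps_const T * fps_X * fps_const w)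
      * (fps_const w - fps_const T * fps_X * fps_const z) + fps_const (T\<^sup>2) * fps_X * D)"
proof -
  text \<open>Shifting the index in one factor gives series \<open>B\<close>, \<open>B'\<close>, \<open>C\<close> that the recurrences express
    through \<open>A\<close> and its derivative; eliminating them leaves a first-order equation for \<open>A\<close>.\<close>
  define B where "B = Abs_fps (\<lambda>k. u (Suc k) * v k / (fact k * L ^ k))"
  define B' where "B' = Abs_fps (\<lambda>k. u k * v (Suc k) / (fact k * L ^ k))"
  define C where "C = Abs_fps (\<lambda>k. u k * v (Suc (Suc k)) / (fact k * L ^ k))"
  have nz: "(1 :: complex) + of_nat k \<noteq> 0" for k
    by (metis of_nat_Suc of_nat_neq_0)
  have eB: "B = fps_const (L * z) * A - fps_const T * (fps_X * B')"
  proof (rule fps_ext)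
    fix k show "B $ k = (fps_const (L * z) * A - fps_const T * (fps_X * B')) $ k"
      by (cases k) (use L in \<open>auto simp: B_def A_def B'_def u[of k] divide_simps nz\<close>, auto simp: u algebra_simps)
  qed
  have eB': "B' = fps_const (L * w) * A - fps_const T * (fps_X * B)"
  proof (rule fps_ext)
    fix k show "B' $ k = (fps_const (L * w) * A - fps_const T * (fps_X * B)) $ k"
      by (cases k) (use L in \<open>auto simp: B_def A_def B'_def v[of k] divide_simps nz\<close>, auto simp: v algebra_simps)
  qed
  have eA: "fps_const L * fps_deriv A = fps_const (L * z) * B' - fps_const T * (fps_X * C)"
  proof (rule fps_ext)
    fix k
    have "(fps_const L * fps_deriv A) $ k = u (Suc k) * v (Suc k) / (fact k * L ^ k)"
      using L by (simp add: A_def divide_simps del: of_nat_Suc)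
    also have "\<dots> = (fps_const (L * z) * B' - fps_const T * (fps_X * C)) $ k"
      by (cases k) (use L in \<open>auto simp: A_def B'_def C_def divide_simps nz\<close>, auto simp: u algebra_simps)
    finally show "(fps_const L * fps_deriv A) $ k = (fps_const (L * z) * B' - fps_const T * (fps_X * C)) $ k" .
  qed
  \<comment> \<open>The recurrence for \<open>v\<close> at index \<open>Suc k\<close> carries a
    factor k + 1, which turns \<open>A\<close> into \<open>A + fps_X * fps_deriv A\<close>. This
    closes the system.\<close>
  have eC: "C = fps_const (L * w) * B' - fps_const (T * L) * (A + fps_X * fps_deriv A)"
  proof (rule fps_ext)
    fix k show "C $ k = (fps_const (L * w) * B' - fps_const (T * L) * (A + fps_X * fps_deriv A)) $ k"
      by (cases k) (use L in \<open>auto simp: A_def B'_def C_def divide_simps nz\<close>, auto simp: v algebra_simps)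
  qed
  define cL cT cz cw x where "cL = fps_const L" and "cT = fps_const T" and "cz = fps_const z"
    and "cw = fps_const w" and "x = (fps_X :: complex fps)"
  note cs = fps_const_mult[symmetric] cL_def[symmetric] cT_def[symmetric] cz_def[symmetric] cw_def[symmetric] x_def[symmetric]
  have cL0: "cL \<noteq> 0" using L by (simp add: cL_def)
  have D: "D = 1 - cT * cT * x * x"
    by (simp add: D_def cs power2_eq_square mult.assoc)
  have "cL * fps_deriv A = cL * (cz * B' - cT * x * (cw * B' - cT * (A + x * fps_deriv A)))"
    using eA unfolding eC by (simp add: cs algebra_simps)
  then have 1: "fps_deriv A = cz * B' - cT * x * (cw * B' - cT * (A + x * fps_deriv A))"
    using cL0 by simp
  have 2: "fps_deriv A * D = (cz - cT * x * cw) * B' + cT * cT * x * A"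
  proof -
    have "fps_deriv A * D = fps_deriv A - cT * cT * x * x * fps_deriv A" unfolding D by (simp add: algebra_simps)
    also have "\<dots> = (cz * B' - cT * x * (cw * B' - cT * (A + x * fps_deriv A))) - cT * cT * x * x * fps_deriv A"
      using 1 by simp
    finally show ?thesis by (simp add: algebra_simps)
  qed
  \<comment> \<open>Inserting \<open>eB\<close> into \<open>eB'\<close> yields an equation with
    \<open>B'\<close> on both sides, the right-hand occurrence multiplied by
    \<open>cT * cT * x * x\<close>. Multiplication by \<open>D\<close> absorbs it, just as for the
    derivative of \<open>A\<close> in the preceding fact.\<close>
  have 3: "B' * D = cL * (cw - cT * x * cz) * A"
  proof -
    have "B' * D = B' - cT * cT * x * x * B'" unfolding D by (simp add: algebra_simps)
    also have "\<dots> = (cL * cw * A - cT * x * (cL * cz * A - cT * x * B')) - cT * cT * x * x * B'"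
      using eB' unfolding eB by (simp add: cs mult.assoc)
    finally show ?thesis by (simp add: algebra_simps)
  qed
  have "fps_deriv A * D\<^sup>2 = (fps_deriv A * D) * D" by (simp add: power2_eq_square mult.assoc)
  also have "\<dots> = (cz - cT * x * cw) * (B' * D) + cT * cT * x * A * D" unfolding 2 by (simp add: algebra_simps)
  also have "\<dots> = A * (cL * (cz - cT * x * cw) * (cw - cT * x * cz) + cT * cT * x * D)" unfolding 3 by (simp add: algebra_simps)
  finally show ?thesis by (simp add: cs power2_eq_square)
qed

text \<open>The coefficients are identified formally, by the common differential equation and the
  common constant term. Convergence for every s with |T s| < 1 then follows because a Taylor series
  represents its function on any disc of holomorphy.\<close>

lemma mehler_sums:
  fixes u v :: "nat \<Rightarrow> complex" and L T z w :: complex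
  assumes L: "L \<noteq> 0"
    and u: "u 0 = 1" "\<And>k. u (Suc k) = L * z * u k - T * L * of_nat k * u (k - 1)"
    and v: "v 0 = 1" "\<And>k. v (Suc k) = L * w * v k - T * L * of_nat k * v (k - 1)"
    and s: "norm (T * s) < 1"
  shows "(\<lambda>k. u k * v k / (fact k * L ^ k) * s ^ k) sums mehler L T z w s"
proof -
  define S where "S = {s. norm (T * s) < 1}"
  have opS: "open S" unfolding S_def by (intro open_Collect_less continuous_intros)
  have 0: "0 \<in> S" by (simp add: S_def)
  have hol: "mehler L T z w holomorphic_on S" unfolding S_def by (rule mehler_holomorphic)
  define F where "F = fps_expansion (mehler L T z w) 0"
  have F: "mehler L T z w has_fps_expansion F"
    unfolding F_def using opS 0 hol by (rule has_fps_expansion_fps_expansion)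
  define A where "A = Abs_fps (\<lambda>k. u k * v k / (fact k * L ^ k))"
  define D where "D = 1 - fps_const (T\<^sup>2) * (fps_X :: complex fps)\<^sup>2"
  define N where "N = fps_const L * (fps_const z - fps_const T * fps_X * fps_const w)
      * (fps_const w - fps_const T * fps_X * fps_const z) + fps_const (T\<^sup>2) * fps_X * D"
  have F0: "F $ 0 = 1"
    using has_fps_expansion_imp_0_eq_fps_nth_0[OF F] by (simp add: mehler_def)
  have D0: "D $ 0 = 1" by (simp add: D_def)
  \<comment> \<open>Both sides are expansions at 0 of functions that agree near 0 by
    \<open>mehler_deriv\<close>.\<close>
  have "fps_deriv F * D\<^sup>2 = F * N"
  proof (rule fps_expansion_unique_complex)
    show "(\<lambda>s. deriv (mehler L T z w) s * (1 - T\<^sup>2 * s\<^sup>2)\<^sup>2) has_fps_expansion fps_deriv F * D\<^sup>2"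
      unfolding D_def by (intro fps_expansion_intros F)
    have "(\<lambda>s. mehler L T z w s * (L * (z - T * s * w) * (w - T * s * z) + T\<^sup>2 * s * (1 - T\<^sup>2 * s\<^sup>2))) has_fps_expansion F * N"
      unfolding N_def D_def by (intro fps_expansion_intros F)
    moreover have "eventually (\<lambda>s. deriv (mehler L T z w) s * (1 - T\<^sup>2 * s\<^sup>2)\<^sup>2
        = mehler L T z w s * (L * (z - T * s * w) * (w - T * s * z) + T\<^sup>2 * s * (1 - T\<^sup>2 * s\<^sup>2))) (nhds 0)"
    proof (rule eventually_mono[OF eventually_nhds_in_open[OF opS 0]])
      fix s assume "s \<in> S"
      then have s: "norm (T * s) < 1" by (simp add: S_def)
      define E where "E = 1 - T\<^sup>2 * s\<^sup>2"
      have "E \<noteq> 0" using one_minus_square_notin_nonpos_Reals[OF s] by (auto simp: power_mult_distrib E_def)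
      then show "deriv (mehler L T z w) s * (1 - T\<^sup>2 * s\<^sup>2)\<^sup>2
        = mehler L T z w s * (L * (z - T * s * w) * (w - T * s * z) + T\<^sup>2 * s * (1 - T\<^sup>2 * s\<^sup>2))"
        unfolding DERIV_imp_deriv[OF mehler_deriv[OF s]] E_def[symmetric]
        by (simp add: divide_simps) (simp add: algebra_simps power2_eq_square)
    qed
    ultimately show "(\<lambda>s. deriv (mehler L T z w) s * (1 - T\<^sup>2 * s\<^sup>2)\<^sup>2) has_fps_expansion F * N"
      by (subst has_fps_expansion_cong[OF _ refl])
  qed
  moreover have "fps_deriv A * D\<^sup>2 = A * N"
    unfolding A_def D_def N_def by (rule hermite_product_fps_ode[OF L u(2) v(2)])
  moreover have "D\<^sup>2 \<noteq> 0" using D0 by auto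
  ultimately have "A = F"
    using F0 u(1) v(1) by (intro fps_log_deriv_unique[of A "D\<^sup>2" N F]) (auto simp: A_def)
  \<comment> \<open>A disc around 0 that contains s and still lies in the domain of holomorphy; for
    \<open>T = 0\<close> that domain is the whole plane and any larger radius will do.\<close>
  obtain r where r: "norm s < r" "norm T * r < 1"
  proof (cases "T = 0")
    case True
    then show ?thesis using that[of "norm s + 1"] by simp
  next
    case False
    then have "norm s < 1 / norm T" using s by (simp add: norm_mult field_simps)
    then obtain r where "norm s < r" "r < 1 / norm T" using dense by blast
    then show ?thesis using that[of r] False by (simp add: field_simps)
  qed
  have "mehler L T z w holomorphic_on eball 0 (ereal r)"
  proof (rule holomorphic_on_subset[OF hol])
    show "eball 0 (ereal r) \<subseteq> S"
    proof
      fix x :: complex assume "x \<in> eball 0 (ereal r)"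
      then have "norm T * norm x \<le> norm T * r" by (intro mult_left_mono) auto
      then show "x \<in> S" using r by (simp add: S_def norm_mult)
    qed
  qed
  from has_fps_expansion_imp_sums_complex[OF F this, of s] r \<open>A = F\<close>[symmetric] show ?thesis
    by (simp add: A_def)
qed

subsection \<open>The density as a distribution function\<close>

text \<open>The function G of the overview, over a general field because the tail bounds evaluate it
  at real points and the characteristic functions at complex ones.\<close>

definition pgf_exponent :: "real \<Rightarrow> complex \<Rightarrow> 'a::real_normed_field \<Rightarrow> 'a" where
  "pgf_exponent t z s = of_real (1 - t\<^sup>2) *
     (of_real ((Re z)\<^sup>2) * (s / (1 + of_real t * s)) + of_real ((Im z)\<^sup>2) * (s / (1 - of_real t * s)))"

definition pgf :: "real \<Rightarrow> real \<Rightarrow> complex \<Rightarrow> complex \<Rightarrow> complex" where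
  "pgf t \<nu> z s = of_real (sqrt (1 - t\<^sup>2)) *
     exp (of_real \<nu> * (pgf_exponent t z s - pgf_exponent t z 1)) / csqrt (1 - (of_real t * s)\<^sup>2)"

lemma pgf_exponent_of_real:
  "pgf_exponent t z (complex_of_real s) = of_real (pgf_exponent t z s)"
  by (simp add: pgf_exponent_def)

text \<open>This coincidence makes the density a probability: the factor
  \<open>exp (- (n * V z))\<close> of the density is exactly what cancels the exponential of
  Mehler's kernel at s = 1.\<close>

lemma pgf_exponent_1:
  assumes "0 < t" "t < 1"
  shows "pgf_exponent t z 1 = elliptic_potential t z"
proof -
  have "1 - t\<^sup>2 = (1 - t) * (1 + t)" by (simp add: algebra_simps power2_eq_square)
  then have "(1 - t\<^sup>2) * (a * (1 / (1 + t)) + b * (1 / (1 - t))) = (1 - t) * a + (1 + t) * b" for a b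
    using assms by (simp add: divide_simps)
  then have "pgf_exponent t z 1 = (1 - t) * (Re z)\<^sup>2 + (1 + t) * (Im z)\<^sup>2"
    by (simp add: pgf_exponent_def)
  also have "\<dots> = elliptic_potential t z"
    unfolding elliptic_potential_def cmod_power2 by (simp add: algebra_simps power2_eq_square)
  finally show ?thesis .
qed

text \<open>The second point is the conjugate because the Hermite polynomials are real. In the
  coordinates x and y the numerator splits, and each part cancels one factor of
  \<open>1 - T\<^sup>2 * s\<^sup>2 = (1 + T * s) * (1 - T * s)\<close>.\<close>

lemma mehler_conv_pgf_exponent:
  fixes s :: complex
  assumes "norm (of_real t * s) < 1"
  shows "mehler (of_real (\<nu> * (1 - t\<^sup>2))) (of_real t) z (cnj z) s
     = exp (of_real \<nu> * pgf_exponent t z s) / csqrt (1 - (of_real t * s)\<^sup>2)"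
proof -
  define T X Y where "T = complex_of_real t" and "X = complex_of_real (Re z)" and "Y = complex_of_real (Im z)"
  have z: "z = X + \<i> * Y" "cnj z = X - \<i> * Y" by (simp_all add: X_def Y_def complex_eq_iff)
  have ne: "1 + T * s \<noteq> 0" "1 - T * s \<noteq> 0"
    using assms by (auto simp: T_def norm_minus_cancel dest: arg_cong[of _ _ norm] simp flip: eq_neg_iff_add_eq_0)
  have D: "1 - T\<^sup>2 * s\<^sup>2 = (1 + T * s) * (1 - T * s)" by (simp add: algebra_simps power2_eq_square)
  have "(s * z * cnj z - s\<^sup>2 * T / 2 * (z\<^sup>2 + (cnj z)\<^sup>2)) = X\<^sup>2 * (s * (1 - T * s)) + Y\<^sup>2 * (s * (1 + T * s))"
    unfolding z(2) by (subst (1 2) z(1)) (simp add: field_simps power2_eq_square)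
  then have "(s * z * cnj z - s\<^sup>2 * T / 2 * (z\<^sup>2 + (cnj z)\<^sup>2)) / (1 - T\<^sup>2 * s\<^sup>2)
      = X\<^sup>2 * (s / (1 + T * s)) + Y\<^sup>2 * (s / (1 - T * s))"
    unfolding D using ne by (simp add: divide_simps) 
  then have "of_real (\<nu> * (1 - t\<^sup>2)) * (s * z * cnj z - s\<^sup>2 * T / 2 * (z\<^sup>2 + (cnj z)\<^sup>2)) / (1 - T\<^sup>2 * s\<^sup>2)
      = of_real \<nu> * pgf_exponent t z s"
    unfolding times_divide_eq_right[symmetric]
    by (simp add: pgf_exponent_def T_def X_def Y_def)
  then show ?thesis by (simp add: mehler_def T_def power_mult_distrib)
qed

section \<open>The probability weights\<close>

context elliptic_weight begin

text \<open>The commutation relation of ladder operators: differentiation and \<open>raise\<close>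
  commute up to the scalar \<open>lam\<close>. It makes the derivative of a Hermite polynomial a
  multiple of its predecessor, and so yields the three-term recurrence that
  \<open>mehler_sums\<close> requires.\<close>

lemma pderiv_raise: "pderiv (raise g) = smult (of_real lam) g + raise (pderiv g)"
  by (simp add: raise_def pderiv_diff pderiv_smult pderiv_pCons smult_add_right algebra_simps)

lemma pderiv_herm: "pderiv (herm (Suc k)) = smult (of_real lam * of_nat (Suc k)) (herm k)"
proof (induction k)
  case 0
  show ?case by (simp add: herm_Suc pderiv_raise) (simp add: raise_def)
next
  case (Suc k)
  have raise_smult: "raise (smult c g) = smult c (raise g)" for c g
    by (simp add: raise_def pderiv_smult smult_diff_right mult_ac)
  show ?case
    unfolding herm_Suc[of "Suc k"] pderiv_raise Suc raise_smult herm_Suc[of k, symmetric]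
    by (simp add: smult_add_left[symmetric] algebra_simps)
qed

lemma poly_herm_Suc:
  "poly (herm (Suc k)) z = of_real lam * z * poly (herm k) z
     - of_real t * of_real lam * of_nat k * poly (herm (k - 1)) z"
proof (cases k)
  case 0
  then show ?thesis by (simp add: herm_Suc raise_def)
next
  case (Suc j)
  show ?thesis unfolding herm_Suc[of k]
    by (simp add: Suc raise_def pderiv_herm mult.assoc del: of_nat_Suc)
qed

lemma cnj_poly_herm: "poly (herm k) (cnj z) = cnj (poly (herm k) z)"
  by (induction k rule: induct_nat_012) (simp_all add: poly_herm_Suc)

text \<open>Since \<open>sqrt (1 - t\<^sup>2)\<close> equals
  \<open>pi / (\<nu> * total_mass)\<close>, this is pi times the summand of index k in the
  density.\<close>

definition prob_weight :: "complex \<Rightarrow> nat \<Rightarrow> real" where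
  "prob_weight z k = sqrt (1 - t\<^sup>2) * exp (- (\<nu> * elliptic_potential t z)) * (cmod (poly (herm k) z))\<^sup>2 / (fact k * lam ^ k)"

lemma prob_weight_nonneg: "prob_weight z k \<ge> 0"
  using lam_pos t_pos t_less by (simp add: prob_weight_def abs_square_le_1)

lemma prob_weight_sums:
  assumes "norm (of_real t * s) < 1"
  shows "(\<lambda>k. of_real (prob_weight z k) * s ^ k) sums pgf t \<nu> z s"
proof -
  define c where "c = complex_of_real (sqrt (1 - t\<^sup>2) * exp (- (\<nu> * elliptic_potential t z)))"
  have "(\<lambda>k. poly (herm k) z * poly (herm k) (cnj z) / (fact k * of_real lam ^ k) * s ^ k)
     sums mehler (of_real lam) (of_real t) z (cnj z) s"
    using lam_pos poly_herm_Suc by (intro mehler_sums[OF _ _ _ _ _ assms]) auto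
  then have "(\<lambda>k. c * (poly (herm k) z * poly (herm k) (cnj z) / (fact k * of_real lam ^ k) * s ^ k))
     sums (c * mehler (of_real lam) (of_real t) z (cnj z) s)"
    by (rule sums_mult)
  moreover have "c * (poly (herm k) z * poly (herm k) (cnj z) / (fact k * of_real lam ^ k) * s ^ k)
     = of_real (prob_weight z k) * s ^ k" for k
  proof -
    have "poly (herm k) z * poly (herm k) (cnj z) = of_real ((cmod (poly (herm k) z))\<^sup>2)"
      by (simp only: cnj_poly_herm complex_norm_square)
    then show ?thesis by (simp add: c_def prob_weight_def)
  qed
  moreover have "c * mehler (of_real lam) (of_real t) z (cnj z) s = pgf t \<nu> z s"
  proof -
    have "pgf_exponent t z (1::complex) = of_real (elliptic_potential t z)"
      using pgf_exponent_of_real[of t z 1] pgf_exponent_1[OF t_pos t_less] by simp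
    moreover have "exp (complex_of_real \<nu> * of_real (elliptic_potential t z)) = of_real (exp (\<nu> * elliptic_potential t z))"
      by (simp flip: exp_of_real)
    ultimately show ?thesis
      unfolding lam_def mehler_conv_pgf_exponent[OF assms] pgf_def c_def
      by (simp add: right_diff_distrib exp_diff exp_minus divide_simps)
  qed
  ultimately show ?thesis by simp
qed

lemma density_conv_prob_weight:
  "1 / \<nu> * exp (- (\<nu> * elliptic_potential t z)) * (\<Sum>k<n. (cmod (poly (onp k) z))\<^sup>2) = 1 / pi * (\<Sum>k<n. prob_weight z k)"
  unfolding sum_distrib_left
proof (rule sum.cong[OF refl])
  fix k
  show "1 / \<nu> * exp (- (\<nu> * elliptic_potential t z)) * (cmod (poly (onp k) z))\<^sup>2 = 1 / pi * prob_weight z k"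
    using lam_pos nu_pos unfolding cmod_poly_onp prob_weight_def hnorm_def total_mass_def
    by (simp add: field_simps)
qed

end

text \<open>The interface to the probabilistic half: from here on only nonnegativity of the weights
  and their generating function enter, and the polynomials disappear.\<close>

lemma elliptic_density_as_probability:
  assumes "0 < t" "t < 1" "n > 0"
  obtains w :: "nat \<Rightarrow> real" where "\<And>k. w k \<ge> 0"
    "\<And>s. norm (of_real t * s) < 1 \<Longrightarrow> (\<lambda>k. of_real (w k) * s ^ k) sums pgf t (real n) z s"
    "eigenvalue_density (elliptic_potential t) n z = 1 / pi * (\<Sum>k<n. w k)"
proof -
  interpret elliptic_weight t "real n" using assms by unfold_locales auto
  show ?thesis
    using prob_weight_nonneg prob_weight_sums density_conv_prob_weight[of z n]
    by (intro that[of "prob_weight z"]) (auto simp: eigenvalue_density_def orthonormal_poly_elliptic[OF assms])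
qed

section \<open>Exponential tail bounds off the ellipse\<close>

definition pgf_real :: "real \<Rightarrow> real \<Rightarrow> complex \<Rightarrow> real \<Rightarrow> real" where
  "pgf_real t \<nu> z s = sqrt (1 - t\<^sup>2) / sqrt (1 - (t * s)\<^sup>2) * exp (\<nu> * (pgf_exponent t z s - pgf_exponent t z 1))"

lemma pgf_of_real:
  assumes "\<bar>t * s\<bar> < 1"
  shows "pgf t \<nu> z (of_real s) = of_real (pgf_real t \<nu> z s)"
proof -
  have "(t * s)\<^sup>2 \<le> 1" using assms by (simp add: abs_square_le_1)
  then have "csqrt (1 - (of_real t * of_real s)\<^sup>2) = of_real (sqrt (1 - (t * s)\<^sup>2))"
    using csqrt_of_real_nonneg[of "1 - (t * s)\<^sup>2"] by simp
  moreover have "pgf_exponent t z (1::complex) = of_real (pgf_exponent t z 1)"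
    using pgf_exponent_of_real[of t z 1] by simp
  ultimately show ?thesis
    by (simp add: pgf_def pgf_real_def pgf_exponent_of_real exp_of_real[symmetric])
qed

lemma pgf_1: "0 < t \<Longrightarrow> t < 1 \<Longrightarrow> pgf t \<nu> z 1 = 1"
  using pgf_of_real[of t 1 \<nu> z] by (simp add: pgf_real_def abs_square_less_1 abs_square_eq_1)

lemma real_sums_pgf:
  fixes w :: "nat \<Rightarrow> real"
  assumes "\<And>s. norm (of_real t * s) < 1 \<Longrightarrow> (\<lambda>k. of_real (w k) * s ^ k) sums pgf t \<nu> z s"
    and "\<bar>t * s\<bar> < 1"
  shows "(\<lambda>k. w k * s ^ k) sums pgf_real t \<nu> z s"
  using assms(1)[of "of_real s"] assms(2) unfolding pgf_of_real[OF assms(2)]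
  by (simp flip: of_real_power of_real_mult add: sums_of_real_iff abs_mult)

text \<open>Markov's inequality for s^X: when s is at least 1, the indicator of k >= n is bounded by
  s^(k - n).\<close>

lemma chernoff_upper:
  fixes w :: "nat \<Rightarrow> real"
  assumes w: "\<And>k. w k \<ge> 0" "w sums 1" and P: "(\<lambda>k. w k * s ^ k) sums P" and s: "s \<ge> 1"
  shows "1 - P / s ^ n \<le> (\<Sum>k<n. w k)"
proof -
  have "(\<lambda>k. if k < n then w k else 0) sums (\<Sum>k<n. w k)"
    using sums_If_finite_set[of "{..<n}" w] by simp
  from sums_diff[OF w(2) this] have "(\<lambda>k. w k - (if k < n then w k else 0)) sums (1 - (\<Sum>k<n. w k))" .
  moreover have "w k - (if k < n then w k else 0) \<le> w k * s ^ k / s ^ n" for k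
  proof (cases "k < n")
    case False
    then have "s ^ n \<le> s ^ k" using s by (intro power_increasing) auto
    then have "w k * s ^ n \<le> w k * s ^ k" using w(1) by (intro mult_left_mono) auto
    then show ?thesis using False s by (simp add: field_simps)
  qed (use w(1)[of k] s in simp)
  ultimately have "1 - (\<Sum>k<n. w k) \<le> P / s ^ n"
    by (intro sums_le[OF _ _ sums_divide[OF P]])
  then show ?thesis by simp
qed

lemma chernoff_lower:
  fixes w :: "nat \<Rightarrow> real"
  assumes w: "\<And>k. w k \<ge> 0" and P: "(\<lambda>k. w k * s ^ k) sums P" and s: "0 < s" "s \<le> 1"
  shows "(\<Sum>k<n. w k) \<le> P / s ^ n"
proof -
  have "(\<Sum>k<n. w k) \<le> (\<Sum>k<n. w k * s ^ k / s ^ n)"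
  proof (rule sum_mono)
    fix k assume "k \<in> {..<n}"
    then have "s ^ n \<le> s ^ k" using s by (intro power_decreasing) auto
    then have "w k * s ^ n \<le> w k * s ^ k" using w by (intro mult_left_mono) auto
    then show "w k \<le> w k * s ^ k / s ^ n" using s by (simp add: field_simps)
  qed
  also have "\<dots> = (\<Sum>k<n. w k * s ^ k) / s ^ n" by (simp add: sum_divide_distrib)
  also have "\<dots> \<le> P / s ^ n"
    using sum_le_suminf[OF sums_summable[OF P], of "{..<n}"] w s sums_unique[OF P]
    by (intro divide_right_mono) auto
  finally show ?thesis .
qed

text \<open>In this form the quadratic form is visibly G'(1), because s / (1 + t s) and s / (1 - t
  s) have derivatives 1 / (1 + t)^2 and 1 / (1 - t)^2 at s = 1.\<close>

lemma ellipse_form_eq: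
  assumes "0 < t" "t < 1"
  shows "ellipse_form t z = (1 - t\<^sup>2) * ((Re z)\<^sup>2 / (1 + t)\<^sup>2 + (Im z)\<^sup>2 / (1 - t)\<^sup>2)"
proof -
  have e: "1 - t\<^sup>2 = (1 - t) * (1 + t)" by (simp add: algebra_simps power2_eq_square)
  have ax: "(semi_axis_re t)\<^sup>2 = (1 + t) / (1 - t)" "(semi_axis_im t)\<^sup>2 = (1 - t) / (1 + t)"
    using assms by (simp_all add: semi_axis_re_def semi_axis_im_def)
  have cancel: "(1 - t) * (1 + t) * (x / (1 + t)\<^sup>2) = x / ((1 + t) / (1 - t))"
    "(1 - t) * (1 + t) * (x / (1 - t)\<^sup>2) = x / ((1 - t) / (1 + t))" for x
    using assms by (simp_all add: divide_simps) (simp_all add: power2_eq_square)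
  show ?thesis unfolding ellipse_form_def e ax distrib_left[of "(1 - t) * (1 + t)"] cancel ..
qed

text \<open>The function differentiated is the exponential rate of the tail bound. It vanishes at s
  = 1, so the sign of its slope there decides on which side of 1 a bound with negative rate
  exists.\<close>

lemma pgf_exponent_has_deriv:
  assumes "0 < t" "t < 1"
  shows "((\<lambda>s. pgf_exponent t z s - pgf_exponent t z 1 - ln s) has_real_derivative (ellipse_form t z - 1)) (at 1)"
proof -
  have "((\<lambda>s. s / (1 + t * s)) has_real_derivative 1 / (1 + t)\<^sup>2) (at 1)"
    "((\<lambda>s. s / (1 - t * s)) has_real_derivative 1 / (1 - t)\<^sup>2) (at 1)"
    using assms by (auto intro!: derivative_eq_intros simp: power2_eq_square)
  note d = DERIV_cmult[OF DERIV_add[OF DERIV_cmult[OF this(1), of "(Re z)\<^sup>2"] DERIV_cmult[OF this(2), of "(Im z)\<^sup>2"]], of "1 - t\<^sup>2"]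
  have "((\<lambda>s. pgf_exponent t z s) has_real_derivative ellipse_form t z) (at 1)"
    using d by (simp add: pgf_exponent_def ellipse_form_eq[OF assms])
  then show ?thesis by (auto intro!: derivative_eq_intros)
qed

text \<open>The rate is continuous in z, so strict negativity at the limit point \<open>z0\<close>
  makes the exponent tend to minus infinity along the moving points; the remaining factor does not
  depend on n.\<close>

lemma pgf_real_power_tendsto_0:
  assumes s: "0 < s" "\<bar>t * s\<bar> < 1" and t: "0 < t" "t < 1"
    and z: "z \<longlonglongrightarrow> z0" and neg: "pgf_exponent t z0 s - pgf_exponent t z0 1 - ln s < 0"
  shows "(\<lambda>n. pgf_real t (real n) (z n) s / s ^ n) \<longlonglongrightarrow> 0"
proof -
  define h where "h z = pgf_exponent t z s - pgf_exponent t z 1 - ln s" for z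
  have eq: "pgf_real t (real n) (z n) s / s ^ n = sqrt (1 - t\<^sup>2) / sqrt (1 - (t * s)\<^sup>2) * exp (real n * h (z n))" for n
  proof -
    have "exp (real n * h (z n)) = exp (real n * (pgf_exponent t (z n) s - pgf_exponent t (z n) 1)) / exp (real n * ln s)"
      by (simp add: h_def exp_diff[symmetric] algebra_simps)
    also have "exp (real n * ln s) = s ^ n" using s by (simp add: exp_of_nat_mult)
    finally show ?thesis by (simp add: pgf_real_def)
  qed
  have "(\<lambda>n. h (z n)) \<longlonglongrightarrow> h z0"
    unfolding h_def pgf_exponent_def by (intro tendsto_intros z)
  then have "filterlim (\<lambda>n. h (z n) * real n) at_bot sequentially"
    using neg by (intro filterlim_tendsto_neg_mult_at_bot filterlim_real_sequentially) (auto simp: h_def)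
  then have "(\<lambda>n. exp (real n * h (z n))) \<longlonglongrightarrow> 0"
    by (intro filterlim_compose[OF exp_at_bot]) (simp add: mult.commute)
  then show ?thesis unfolding eq by (rule tendsto_mult_right_zero)
qed

lemma density_inside:
  assumes t: "0 < t" "t < 1" and z: "z \<longlonglongrightarrow> z0" and inside: "ellipse_form t z0 < 1"
  shows "(\<lambda>n. eigenvalue_density (elliptic_potential t) n (z n)) \<longlonglongrightarrow> 1 / pi"
proof -
  have "\<exists>d>0. \<forall>h>0::real. h < d \<longrightarrow> pgf_exponent t z0 (1 + h) - pgf_exponent t z0 1 < ln (1 + h)"
    using DERIV_neg_dec_right[OF pgf_exponent_has_deriv[OF t, of z0]] inside by simp
  then obtain d where d: "d > 0" "\<forall>h>0::real. h < d \<longrightarrow> pgf_exponent t z0 (1 + h) - pgf_exponent t z0 1 < ln (1 + h)"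
    by blast
  \<comment> \<open>The second bound keeps s = 1 + h below 1 / t, inside the disc where the
    generating function is known.\<close>
  define h where "h = min (d / 2) ((1 / t - 1) / 2)"
  have h: "h > 0" "h < d" "t * (1 + h) < 1"
  proof -
    have "1 + h < 1 / t" using t by (auto simp: h_def min_def field_simps)
    then show "t * (1 + h) < 1" using t by (simp add: field_simps)
  qed (use d t in \<open>auto simp: h_def min_def field_simps\<close>)
  define s where "s = 1 + h"
  have s: "s \<ge> 1" "\<bar>t * s\<bar> < 1" using h t by (auto simp: s_def)
  have lim: "(\<lambda>n. pgf_real t (real n) (z n) s / s ^ n) \<longlonglongrightarrow> 0"
    using d(2) h s by (intro pgf_real_power_tendsto_0[OF _ _ t z]) (auto simp: s_def)
  have bounds: "1 / pi * (1 - pgf_real t (real n) (z n) s / s ^ n) \<le> eigenvalue_density (elliptic_potential t) n (z n) \<and>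
      eigenvalue_density (elliptic_potential t) n (z n) \<le> 1 / pi" if n: "n > 0" for n
  proof -
    obtain w where w: "\<And>k. w k \<ge> 0"
      "\<And>s. norm (of_real t * s) < 1 \<Longrightarrow> (\<lambda>k. of_real (w k) * s ^ k) sums pgf t (real n) (z n) s"
      "eigenvalue_density (elliptic_potential t) n (z n) = 1 / pi * (\<Sum>k<n. w k)"
      using elliptic_density_as_probability[OF t n, where z = "z n"] by blast
    have w1: "w sums 1" using real_sums_pgf[OF w(2), of 1] t
      by (simp add: pgf_real_def abs_square_less_1 abs_square_eq_1)
    have "(\<Sum>k<n. w k) \<le> 1" using sum_le_suminf[OF sums_summable[OF w1], of "{..<n}"] w(1) sums_unique[OF w1] by simp
    with chernoff_upper[OF w(1) w1 real_sums_pgf[OF w(2) s(2)] s(1), of n] show ?thesis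
      unfolding w(3) by (auto intro!: mult_left_mono divide_right_mono)
  qed
  show ?thesis
  proof (rule tendsto_sandwich)
    show "(\<lambda>n. 1 / pi * (1 - pgf_real t (real n) (z n) s / s ^ n)) \<longlonglongrightarrow> 1 / pi"
      by (rule tendsto_eq_intros tendsto_mult tendsto_diff lim refl)+ simp
    show "eventually (\<lambda>n. 1 / pi * (1 - pgf_real t (real n) (z n) s / s ^ n) \<le> eigenvalue_density (elliptic_potential t) n (z n)) sequentially"
      using bounds by (intro eventually_mono[OF eventually_gt_at_top[of 0]]) auto
    show "eventually (\<lambda>n. eigenvalue_density (elliptic_potential t) n (z n) \<le> 1 / pi) sequentially"
      using bounds by (intro eventually_mono[OF eventually_gt_at_top[of 0]]) auto
  qed simp
qed

lemma density_outside:
  assumes t: "0 < t" "t < 1" and z: "z \<longlonglongrightarrow> z0" and outside: "ellipse_form t z0 > 1"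
  shows "(\<lambda>n. eigenvalue_density (elliptic_potential t) n (z n)) \<longlonglongrightarrow> 0"
proof -
  have "\<exists>d>0. \<forall>h>0::real. h < d \<longrightarrow> pgf_exponent t z0 (1 - h) - pgf_exponent t z0 1 < ln (1 - h)"
    using DERIV_pos_inc_left[OF pgf_exponent_has_deriv[OF t, of z0]] outside by simp
  then obtain d where d: "d > 0" "\<forall>h>0::real. h < d \<longrightarrow> pgf_exponent t z0 (1 - h) - pgf_exponent t z0 1 < ln (1 - h)"
    by blast
  \<comment> \<open>The second bound keeps s = 1 - h positive.\<close>
  define h where "h = min (d / 2) (1 / 2)"
  have h: "h > 0" "h < d" "h < 1" using d by (auto simp: h_def min_def)
  define s where "s = 1 - h"
  have "t * s < t * 1" using h t by (intro mult_strict_left_mono) (auto simp: s_def)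
  moreover have s: "0 < s" "s \<le> 1" using h by (auto simp: s_def)
  moreover have "0 < t * s" using t s by simp
  ultimately have ts: "\<bar>t * s\<bar> < 1" using t by linarith
  have lim: "(\<lambda>n. pgf_real t (real n) (z n) s / s ^ n) \<longlonglongrightarrow> 0"
    using d(2) h s ts by (intro pgf_real_power_tendsto_0[OF _ _ t z]) (auto simp: s_def)
  have bounds: "eigenvalue_density (elliptic_potential t) n (z n) \<le> 1 / pi * (pgf_real t (real n) (z n) s / s ^ n) \<and>
      0 \<le> eigenvalue_density (elliptic_potential t) n (z n)" if n: "n > 0" for n
  proof -
    obtain w where w: "\<And>k. w k \<ge> 0"
      "\<And>s. norm (of_real t * s) < 1 \<Longrightarrow> (\<lambda>k. of_real (w k) * s ^ k) sums pgf t (real n) (z n) s"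
      "eigenvalue_density (elliptic_potential t) n (z n) = 1 / pi * (\<Sum>k<n. w k)"
      using elliptic_density_as_probability[OF t n, where z = "z n"] by blast
    show ?thesis
      unfolding w(3)
      using mult_left_mono[OF chernoff_lower[OF w(1) real_sums_pgf[OF w(2) ts] s(1,2), of n], of "1 / pi"]
        sum_nonneg[of "{..<n}" w] w(1)
      by simp
  qed
  show ?thesis
  proof (rule tendsto_sandwich[where f = "\<lambda>n. 0" and h = "\<lambda>n. 1 / pi * (pgf_real t (real n) (z n) s / s ^ n)"])
    show "(\<lambda>n. 1 / pi * (pgf_real t (real n) (z n) s / s ^ n)) \<longlonglongrightarrow> 0"
      by (rule tendsto_mult_right_zero[OF lim])
    show "eventually (\<lambda>n. eigenvalue_density (elliptic_potential t) n (z n) \<le> 1 / pi * (pgf_real t (real n) (z n) s / s ^ n)) sequentially"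
      using bounds by (intro eventually_mono[OF eventually_gt_at_top[of 0]]) auto
    show "eventually (\<lambda>n. 0 \<le> eigenvalue_density (elliptic_potential t) n (z n)) sequentially"
      using bounds by (intro eventually_mono[OF eventually_gt_at_top[of 0]]) auto
  qed simp
qed

subsection \<open>The central limit theorem on the ellipse\<close>

lemma cdf_std_normal_erfc:
  "cdf std_normal_distribution x = 1 / 2 * erfc (- x / sqrt 2)"
proof -
  interpret N: real_distribution std_normal_distribution by (rule real_dist_normal_dist)
  have "cdf std_normal_distribution x = (LINT y|std_normal_distribution. indicator {..x} y)"
    by (simp add: cdf_def)
  also have "\<dots> = (LBINT y. std_normal_density y * indicator {..x} y)"
    by (subst integral_density) (auto simp: normal_density_nonneg)
  \<comment> \<open>The substitution by \<open>- sqrt 2 * y\<close> removes the 1/2 from the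
    Gaussian exponent and reflects the left half-line into the right one over which
    \<open>erfc\<close> integrates.\<close>
  also have "\<dots> = sqrt 2 * (LBINT y. std_normal_density (- sqrt 2 * y) * indicator {..x} (- sqrt 2 * y))"
    by (subst lborel_integral_real_affine[of "- sqrt 2" _ 0]) auto
  also have "(\<lambda>y. std_normal_density (- sqrt 2 * y) * indicator {..x} (- sqrt 2 * y))
     = (\<lambda>y. 1 / sqrt (2 * pi) * (indicator {- x / sqrt 2..} y * exp (- y\<^sup>2)))"
  proof
    fix y
    have "- (sqrt 2 * y) \<le> x \<longleftrightarrow> - x / sqrt 2 \<le> y"
      by (simp add: divide_simps) (simp add: algebra_simps, linarith)
    then show "std_normal_density (- sqrt 2 * y) * indicator {..x} (- sqrt 2 * y)
      = 1 / sqrt (2 * pi) * (indicator {- x / sqrt 2..} y * exp (- y\<^sup>2))"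
      by (simp add: std_normal_density_def power_mult_distrib indicator_def)
  qed
  also have "sqrt 2 * (LBINT y. 1 / sqrt (2 * pi) * (indicator {- x / sqrt 2..} y * exp (- y\<^sup>2)))
      = 1 / sqrt pi * (LBINT y. indicator {- x / sqrt 2..} y * exp (- y\<^sup>2))"
    by (subst integral_mult_right_zero) (simp add: real_sqrt_mult)
  also have "\<dots> = 1 / 2 * erfc (- x / sqrt 2)"
    by (simp add: erfc_def set_lebesgue_integral_def)
  finally show ?thesis .
qed

text \<open>Levy's continuity theorem for the variables \<open>c n * X - b n\<close>, whose
  characteristic functions are the generating functions on the unit circle up to a phase. The last
  hypothesis makes the event of not exceeding the fixed \<open>x\<close> coincide exactly with X <
  \<open>N n\<close>, so convergence of the distribution functions at one point suffices.\<close>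

lemma clt_generating_functions:
  fixes w :: "nat \<Rightarrow> nat \<Rightarrow> real" and b c :: "nat \<Rightarrow> real" and Q :: "nat \<Rightarrow> complex \<Rightarrow> complex"
  assumes nonneg: "\<And>n k. w n k \<ge> 0"
    and Q: "\<And>n s. norm s = 1 \<Longrightarrow> (\<lambda>k. of_real (w n k) * s ^ k) sums Q n s"
    and Q1: "\<And>n. Q n 1 = 1"
    and lim: "\<And>\<theta>::real. (\<lambda>n. iexp (- (\<theta> * b n)) * Q n (iexp (\<theta> * c n))) \<longlonglongrightarrow> exp (- (of_real \<theta>)\<^sup>2 / 2)"
    and N: "\<And>n k. c n * real k - b n \<le> x \<longleftrightarrow> k < N n"
  shows "(\<lambda>n. \<Sum>k<N n. w n k) \<longlonglongrightarrow> cdf std_normal_distribution x"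
proof -
  have w1: "w n sums 1" for n
    using Q[of 1 n] sums_of_real_iff[where 'a = complex, of "w n" 1] by (simp add: Q1)
  define p where "p n = embed_pmf (w n)" for n
  have pmf: "pmf (p n) k = w n k" for n k
    unfolding p_def using suminf_ennreal_eq[OF nonneg w1[of n]]
    by (intro pmf_embed_pmf nonneg) (simp add: nn_integral_count_space_nat)
  define M where "M n = distr (measure_pmf (p n)) borel (\<lambda>k. c n * real k - b n)" for n
  interpret M: real_distribution "M n" for n
    unfolding M_def by (rule prob_space.real_distribution_distr[OF prob_space_measure_pmf]) simp
  interpret N: real_distribution std_normal_distribution by (rule real_dist_normal_dist)
  have char: "char (M n) \<theta> = iexp (- (\<theta> * b n)) * Q n (iexp (\<theta> * c n))" for n \<theta>
  proof -
    have "char (M n) \<theta> = (LINT k|measure_pmf (p n). iexp (\<theta> * (c n * real k - b n)))"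
      unfolding char_def M_def by (subst integral_distr) auto
    also have "\<dots> = (LINT k|count_space UNIV. w n k *\<^sub>R iexp (\<theta> * (c n * real k - b n)))"
      unfolding measure_pmf_eq_density by (subst integral_density) (auto simp: pmf nonneg)
    also have "\<dots> = (\<Sum>k. w n k *\<^sub>R iexp (\<theta> * (c n * real k - b n)))"
      using nonneg[of n] w1[of n]
      by (intro integral_count_space_nat) (simp add: integrable_count_space_nat_iff sums_iff)
    also have "(\<lambda>k. w n k *\<^sub>R iexp (\<theta> * (c n * real k - b n)))
       = (\<lambda>k. iexp (- (\<theta> * b n)) * (of_real (w n k) * iexp (\<theta> * c n) ^ k))"
    proof
      fix k
      have "iexp (\<theta> * (c n * real k - b n)) = iexp (- (\<theta> * b n)) * iexp (\<theta> * c n) ^ k"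
        unfolding exp_of_nat_mult[symmetric] exp_add[symmetric] by (simp add: algebra_simps)
      then show "w n k *\<^sub>R iexp (\<theta> * (c n * real k - b n)) = iexp (- (\<theta> * b n)) * (of_real (w n k) * iexp (\<theta> * c n) ^ k)"
        by (simp add: scaleR_conv_of_real mult_ac)
    qed
    also have "(\<Sum>k. iexp (- (\<theta> * b n)) * (of_real (w n k) * iexp (\<theta> * c n) ^ k)) = iexp (- (\<theta> * b n)) * Q n (iexp (\<theta> * c n))"
      by (rule sums_unique[symmetric], rule sums_mult, rule Q) simp
    finally show ?thesis .
  qed
  have "weak_conv_m M std_normal_distribution"
  proof (rule levy_continuity)
    show "(\<lambda>n. char (M n) \<theta>) \<longlonglongrightarrow> char std_normal_distribution \<theta>" for \<theta>
      using lim[of \<theta>] unfolding char char_std_normal_distribution by (simp add: exp_of_real[symmetric])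
  qed (auto intro: M.real_distribution_axioms N.real_distribution_axioms)
  moreover have "isCont (cdf std_normal_distribution) x"
    unfolding N.isCont_cdf
    by (rule measure_eq_0_null_sets)
      (use AE_lborel_singleton[of x] in \<open>auto simp: null_sets_density_iff frequently_def elim: eventually_mono\<close>)
  ultimately have "(\<lambda>n. cdf (M n) x) \<longlonglongrightarrow> cdf std_normal_distribution x"
    by (simp add: weak_conv_m_def weak_conv_def)
  moreover have "cdf (M n) x = (\<Sum>k<N n. w n k)" for n
  proof -
    have "cdf (M n) x = measure (measure_pmf (p n)) {..<N n}"
      unfolding cdf_def M_def by (subst measure_distr) (auto simp: N intro!: arg_cong[of _ _ "measure _"])
    also have "\<dots> = (\<Sum>k<N n. w n k)" by (simp add: measure_measure_pmf_finite pmf)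
    finally show ?thesis .
  qed
  ultimately show ?thesis by simp
qed

section \<open>Second-order expansions along the unit circle\<close>

lemma iexp_expansion_limits:
  fixes q :: real and \<epsilon> :: "nat \<Rightarrow> real"
  assumes e: "\<epsilon> \<longlonglongrightarrow> 0" "\<And>n. \<epsilon> n \<noteq> 0"
  shows "(\<lambda>n. (iexp (q * \<epsilon> n) - 1 - \<i> * of_real (q * \<epsilon> n)) / of_real ((\<epsilon> n)\<^sup>2)) \<longlonglongrightarrow> - (of_real q)\<^sup>2 / 2"
    and "(\<lambda>n. (iexp (q * \<epsilon> n) - 1) / of_real (\<epsilon> n)) \<longlonglongrightarrow> \<i> * of_real q"
proof -
  have "(\<lambda>n. (iexp (q * \<epsilon> n) - 1 - \<i> * of_real (q * \<epsilon> n)) / of_real ((\<epsilon> n)\<^sup>2) - (- (of_real q)\<^sup>2 / 2)) \<longlonglongrightarrow> 0"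
  proof (rule Lim_null_comparison)
    \<comment> \<open>The cubic Taylor remainder \<open>\<bar>q * \<epsilon> n\<bar> ^ 3 / 6\<close>
      divided by \<open>(\<epsilon> n)\<^sup>2\<close>.\<close>
    show "(\<lambda>n. \<bar>q\<bar> ^ 3 / 6 * \<bar>\<epsilon> n\<bar>) \<longlonglongrightarrow> 0"
      using tendsto_mult_right_zero[OF tendsto_rabs_zero[OF e(1)]] .
    show "eventually (\<lambda>n. norm ((iexp (q * \<epsilon> n) - 1 - \<i> * of_real (q * \<epsilon> n)) / of_real ((\<epsilon> n)\<^sup>2) - (- (of_real q)\<^sup>2 / 2))
        \<le> \<bar>q\<bar> ^ 3 / 6 * \<bar>\<epsilon> n\<bar>) sequentially"
    proof (intro always_eventually allI)
      fix n
      have le: "cmod (iexp (q * \<epsilon> n) - (\<Sum>k\<le>2. (\<i> * of_real (q * \<epsilon> n)) ^ k / fact k)) \<le> \<bar>q * \<epsilon> n\<bar> ^ 3 / 6"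
        using iexp_approx1[of "q * \<epsilon> n" 2] by (simp add: eval_nat_numeral)
      have S: "(\<Sum>k\<le>2. (\<i> * of_real (q * \<epsilon> n)) ^ k / fact k) = 1 + \<i> * of_real (q * \<epsilon> n) - of_real ((q * \<epsilon> n)\<^sup>2) / 2"
        by (simp add: eval_nat_numeral algebra_simps)
      have eqn: "iexp (q * \<epsilon> n) - 1 - \<i> * of_real (q * \<epsilon> n) + of_real ((q * \<epsilon> n)\<^sup>2) / 2
          = iexp (q * \<epsilon> n) - (1 + \<i> * of_real (q * \<epsilon> n) - of_real ((q * \<epsilon> n)\<^sup>2) / 2)"
        by (simp only: diff_diff_eq2 diff_diff_eq diff_add_eq)
      have "cmod (iexp (q * \<epsilon> n) - 1 - \<i> * of_real (q * \<epsilon> n) + of_real ((q * \<epsilon> n)\<^sup>2) / 2) \<le> \<bar>q * \<epsilon> n\<bar> ^ 3 / 6"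
        using le[unfolded S] unfolding eqn .
      moreover have "(iexp (q * \<epsilon> n) - 1 - \<i> * of_real (q * \<epsilon> n)) / of_real ((\<epsilon> n)\<^sup>2) - (- (of_real q)\<^sup>2 / 2)
         = (iexp (q * \<epsilon> n) - 1 - \<i> * of_real (q * \<epsilon> n) + of_real ((q * \<epsilon> n)\<^sup>2) / 2) / of_real ((\<epsilon> n)\<^sup>2)"
        using e(2)[of n] by (simp add: add_divide_distrib power_mult_distrib)
      ultimately show "norm ((iexp (q * \<epsilon> n) - 1 - \<i> * of_real (q * \<epsilon> n)) / of_real ((\<epsilon> n)\<^sup>2) - (- (of_real q)\<^sup>2 / 2))
        \<le> \<bar>q\<bar> ^ 3 / 6 * \<bar>\<epsilon> n\<bar>"
        using e(2)[of n] by (simp add: norm_divide norm_power divide_simps abs_mult power_mult_distrib)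
          (simp add: power2_eq_square power3_eq_cube algebra_simps)
    qed
  qed
  then show *: "(\<lambda>n. (iexp (q * \<epsilon> n) - 1 - \<i> * of_real (q * \<epsilon> n)) / of_real ((\<epsilon> n)\<^sup>2)) \<longlonglongrightarrow> - (of_real q)\<^sup>2 / 2"
    by (rule LIM_zero_cancel)
  have "(\<lambda>n. of_real (\<epsilon> n) * ((iexp (q * \<epsilon> n) - 1 - \<i> * of_real (q * \<epsilon> n)) / of_real ((\<epsilon> n)\<^sup>2)) + \<i> * of_real q)
     \<longlonglongrightarrow> of_real 0 * (- (of_real q)\<^sup>2 / 2) + \<i> * of_real q"
    by (intro tendsto_intros * e)
  moreover have "of_real (\<epsilon> n) * ((iexp (q * \<epsilon> n) - 1 - \<i> * of_real (q * \<epsilon> n)) / of_real ((\<epsilon> n)\<^sup>2)) + \<i> * of_real q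
     = (iexp (q * \<epsilon> n) - 1) / of_real (\<epsilon> n)" for n
    using e(2)[of n] by (simp add: divide_simps power2_eq_square)
  ultimately show "(\<lambda>n. (iexp (q * \<epsilon> n) - 1) / of_real (\<epsilon> n)) \<longlonglongrightarrow> \<i> * of_real q" by simp
qed

text \<open>Along s = exp(i q e), differentiation in e is i q times s d/ds. Applied twice to s / (1
  + \<tau> s), the operator s d/ds gives (1 - \<tau>) / (1 + \<tau>)^3 at s = 1, which explains the
  limit. The cases \<tau> = t and \<tau> = -t give the two halves of G.\<close>

lemma moebius_expansion_limit:
  fixes q \<tau> :: real and \<epsilon> :: "nat \<Rightarrow> real"
  assumes e: "\<epsilon> \<longlonglongrightarrow> 0" "\<And>n. \<epsilon> n \<noteq> 0" and \<tau>: "\<bar>\<tau>\<bar> < 1"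
  defines "s \<equiv> \<lambda>n. iexp (q * \<epsilon> n)"
  shows "(\<lambda>n. (s n / (1 + of_real \<tau> * s n) - 1 / (1 + of_real \<tau>) - \<i> * of_real (q * \<epsilon> n) / (1 + of_real \<tau>)\<^sup>2) / of_real ((\<epsilon> n)\<^sup>2))
    \<longlonglongrightarrow> - (of_real q)\<^sup>2 * (1 - of_real \<tau>) / (2 * (1 + of_real \<tau>) ^ 3)"
proof -
  define T where "T = complex_of_real \<tau>"
  define A where "A n = (s n - 1 - \<i> * of_real (q * \<epsilon> n)) / of_real ((\<epsilon> n)\<^sup>2)" for n
  define B where "B n = (s n - 1) / of_real (\<epsilon> n)" for n
  have A: "A \<longlonglongrightarrow> - (of_real q)\<^sup>2 / 2" and B: "B \<longlonglongrightarrow> \<i> * of_real q"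
    unfolding A_def B_def s_def using iexp_expansion_limits[OF e] by auto
  have nT: "norm T < 1" using \<tau> by (simp add: T_def)
  have ne: "1 + T * x \<noteq> 0" if "norm x = 1" for x
  proof
    assume "1 + T * x = 0"
    then have "norm (T * x) = 1" by (metis add.commute add_eq_0_iff norm_minus_cancel norm_one)
    then show False using nT that by (simp add: norm_mult)
  qed
  have ns: "norm (s n) = 1" for n by (simp add: s_def)
  have T1: "1 + T \<noteq> 0" using ne[of 1] by simp
  have s: "s \<longlonglongrightarrow> 1"
  proof -
    have "s \<longlonglongrightarrow> exp (\<i> * of_real (q * 0))" unfolding s_def by (intro tendsto_intros e)
    then show ?thesis by simp
  qed
  \<comment> \<open>Over the common denominator the remainder is a combination of \<open>A n\<close>
    and \<open>B n\<close>, whose limits are known.\<close>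
  have eq: "(A n * (1 + T) - \<i> * of_real q * T * B n) / ((1 + T * s n) * (1 + T)\<^sup>2)
     = (s n / (1 + T * s n) - 1 / (1 + T) - \<i> * of_real (q * \<epsilon> n) / (1 + T)\<^sup>2) / of_real ((\<epsilon> n)\<^sup>2)" for n
  proof -
    define E where "E = complex_of_real (\<epsilon> n)"
    define S where "S = s n"
    define U where "U = \<i> * complex_of_real q"
    have E0: "E \<noteq> 0" using e(2)[of n] by (simp add: E_def)
    have S0: "1 + T * S \<noteq> 0" using ne[OF ns] by (simp add: S_def)
    have u: "\<i> * complex_of_real (q * \<epsilon> n) = U * E" by (simp add: U_def E_def)
    have "A n * (1 + T) - U * T * B n = ((S - 1 - U * E) * (1 + T) - U * E * T * (S - 1)) / E\<^sup>2"
      unfolding A_def B_def u S_def[symmetric] using E0 by (simp add: E_def[symmetric] divide_simps) (simp add: power2_eq_square algebra_simps)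
    also have "(S - 1 - U * E) * (1 + T) - U * E * T * (S - 1) = (S / (1 + T * S) - 1 / (1 + T) - U * E / (1 + T)\<^sup>2) * ((1 + T * S) * (1 + T)\<^sup>2)"
      using S0 T1 by (simp add: divide_simps) (simp add: power2_eq_square algebra_simps)
    finally show ?thesis unfolding u S_def[symmetric] U_def[symmetric] using S0 T1 by (simp add: E_def)
  qed
  have "(\<lambda>n. (A n * (1 + T) - \<i> * of_real q * T * B n) / ((1 + T * s n) * (1 + T)\<^sup>2))
     \<longlonglongrightarrow> (- (of_real q)\<^sup>2 / 2 * (1 + T) - \<i> * of_real q * T * (\<i> * of_real q)) / ((1 + T * 1) * (1 + T)\<^sup>2)"
    using T1 by (intro tendsto_intros A B s) auto
  also have "(- (of_real q)\<^sup>2 / 2 * (1 + T) - \<i> * of_real q * T * (\<i> * of_real q)) / ((1 + T * 1) * (1 + T)\<^sup>2)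
     = - (of_real q)\<^sup>2 * (1 - T) / (2 * (1 + T) ^ 3)"
    using T1 by (simp add: divide_simps) (simp add: power2_eq_square power3_eq_cube algebra_simps)
  finally show ?thesis unfolding eq unfolding T_def .
qed

text \<open>Here \<open>E\<close> stands for 1 / sqrt n, so division by \<open>E\<^sup>2\<close>
  multiplies by n. The hypothesis \<open>one\<close> is the ellipse equation and cancels the term of
  order 1 / \<open>E\<close>; \<open>m\<close> collects the cross terms produced by the shift of the
  point. What remains converges.\<close>

lemma clt_exponent_identity:
  fixes x y A B E u m c K1 K2 R1 R2 :: "'a::field"
  assumes E: "E \<noteq> 0"
    and one: "c * (x\<^sup>2 * K1 + y\<^sup>2 * K2) = 1"
    and m: "c * (2 * x * A * K1 + 2 * y * B * K2) = m"
  shows "(c * ((x + A * E)\<^sup>2 * (u * E * K1 + E\<^sup>2 * R1) + (y + B * E)\<^sup>2 * (u * E * K2 + E\<^sup>2 * R2)) - u * E) / E\<^sup>2 - u * m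
    = u * E * c * (A\<^sup>2 * K1 + B\<^sup>2 * K2) + c * ((x + A * E)\<^sup>2 * R1 + (y + B * E)\<^sup>2 * R2)"
proof -
  have "c * ((x + A * E)\<^sup>2 * (u * E * K1 + E\<^sup>2 * R1) + (y + B * E)\<^sup>2 * (u * E * K2 + E\<^sup>2 * R2)) - u * E
    = u * E * (c * (x\<^sup>2 * K1 + y\<^sup>2 * K2) - 1)
      + E\<^sup>2 * (u * (c * (2 * x * A * K1 + 2 * y * B * K2)) + u * E * c * (A\<^sup>2 * K1 + B\<^sup>2 * K2)
      + c * ((x + A * E)\<^sup>2 * R1 + (y + B * E)\<^sup>2 * R2))"
    by (simp add: power2_eq_square algebra_simps)
  then show ?thesis unfolding one m using E by (simp add: divide_simps)
qed

text \<open>\<open>m\<close> is the derivative of the quadratic form at \<open>z0\<close> in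
  direction \<open>a\<close>, so the mean of X moves by m sqrt n; \<open>\<sigma>\<^sup>2\<close> is
  the variance per n, the value of (s d/ds)^2 G at s = 1.\<close>

lemma density_boundary_cdf:
  fixes t m \<sigma> :: real and z0 a :: complex
  assumes t: "0 < t" "t < 1" and bd: "ellipse_form t z0 = 1"
    and m: "m = (1 - t\<^sup>2) * (2 * Re z0 * Re a / (1 + t)\<^sup>2 + 2 * Im z0 * Im a / (1 - t)\<^sup>2)"
    and \<sigma>: "\<sigma> > 0" "\<sigma>\<^sup>2 = (1 - t\<^sup>2) * ((Re z0)\<^sup>2 * (1 - t) / (1 + t) ^ 3 + (Im z0)\<^sup>2 * (1 + t) / (1 - t) ^ 3)"
  shows "(\<lambda>n. eigenvalue_density (elliptic_potential t) n (z0 + a / complex_of_real (sqrt (real n))))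
    \<longlonglongrightarrow> 1 / pi * cdf std_normal_distribution (- m / \<sigma>)"
proof -
  \<comment> \<open>Everything is indexed by \<open>Suc n\<close>, so that no division by zero
    occurs; \<open>LIMSEQ_imp_Suc\<close> undoes this at the end.\<close>
  define \<epsilon> where "\<epsilon> n = 1 / sqrt (real (Suc n))" for n
  define z where "z n = z0 + a / complex_of_real (sqrt (real (Suc n)))" for n
  have \<epsilon>_pos: "\<epsilon> n > 0" for n by (simp add: \<epsilon>_def)
  have \<epsilon>0: "\<epsilon> \<longlonglongrightarrow> 0" unfolding \<epsilon>_def
    by (intro real_tendsto_divide_at_top[OF tendsto_const] filterlim_compose[OF sqrt_at_top]
        filterlim_compose[OF filterlim_real_sequentially filterlim_Suc])
  have \<epsilon>2: "real (Suc n) = 1 / (\<epsilon> n)\<^sup>2" for n by (simp add: \<epsilon>_def power_divide)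
  have z_eq: "Re (z n) = Re z0 + Re a * \<epsilon> n" "Im (z n) = Im z0 + Im a * \<epsilon> n" for n
    by (simp_all add: z_def \<epsilon>_def del: of_nat_Suc)
  have "\<exists>w. (\<forall>k. w k \<ge> 0) \<and>
      (\<forall>s. norm (of_real t * s) < 1 \<longrightarrow> (\<lambda>k. of_real (w k) * s ^ k) sums pgf t (real (Suc n)) (z n) s) \<and>
      eigenvalue_density (elliptic_potential t) (Suc n) (z n) = 1 / pi * (\<Sum>k<Suc n. w k)" for n
    using elliptic_density_as_probability[OF t zero_less_Suc[of n], where z = "z n"] by metis
  then obtain w where w: "\<And>n k. w n k \<ge> (0::real)"
      "\<And>n s. norm (of_real t * s) < 1 \<Longrightarrow> (\<lambda>k. of_real (w n k) * s ^ k) sums pgf t (real (Suc n)) (z n) s"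
      "\<And>n. eigenvalue_density (elliptic_potential t) (Suc n) (z n) = 1 / pi * (\<Sum>k<Suc n. w n k)"
    by metis
  have "(\<lambda>n. \<Sum>k<Suc n. w n k) \<longlonglongrightarrow> cdf std_normal_distribution (- m / \<sigma>)"
  \<comment> \<open>Centring at n while the parameter is \<open>Suc n\<close> turns the event at
    \<open>- m / \<sigma>\<close> exactly into k < \<open>Suc n\<close>. The discrepancy of one unit
    shows up below as the factor \<open>s n\<close>, which tends to 1.\<close>
  proof (rule clt_generating_functions[where c = "\<lambda>n. \<epsilon> n / \<sigma>" and b = "\<lambda>n. real n * (\<epsilon> n / \<sigma>) + m / \<sigma>"
        and Q = "\<lambda>n. pgf t (real (Suc n)) (z n)"])
    show "(\<lambda>k. of_real (w n k) * s ^ k) sums pgf t (real (Suc n)) (z n) s" if "norm s = 1" for n s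
      by (rule w(2)) (use that t in \<open>simp add: norm_mult\<close>)
    show "pgf t (real (Suc n)) (z n) 1 = 1" for n by (rule pgf_1[OF t])
    show "\<epsilon> n / \<sigma> * real k - (real n * (\<epsilon> n / \<sigma>) + m / \<sigma>) \<le> - m / \<sigma> \<longleftrightarrow> k < Suc n" for n k
    proof -
      have "\<epsilon> n / \<sigma> * real k - (real n * (\<epsilon> n / \<sigma>) + m / \<sigma>) \<le> - m / \<sigma> \<longleftrightarrow> \<epsilon> n / \<sigma> * real k \<le> \<epsilon> n / \<sigma> * real n"
        by (simp add: algebra_simps)
      also have "\<dots> \<longleftrightarrow> k \<le> n" using \<epsilon>_pos[of n] \<sigma>(1) by (subst mult_le_cancel_left_pos) auto
      finally show ?thesis by auto
    qed
    fix \<theta> :: real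
    define q where "q = \<theta> / \<sigma>"
    define s where "s n = iexp (q * \<epsilon> n)" for n
    define T where "T = complex_of_real t"
    define K1 K2 where "K1 = 1 / (1 + T)\<^sup>2" and "K2 = 1 / (1 - T)\<^sup>2"
    define R1 where "R1 = (\<lambda>n. (s n / (1 + T * s n) - 1 / (1 + T) - \<i> * of_real (q * \<epsilon> n) / (1 + T)\<^sup>2) / of_real ((\<epsilon> n)\<^sup>2))"
    define R2 where "R2 = (\<lambda>n. (s n / (1 - T * s n) - 1 / (1 - T) - \<i> * of_real (q * \<epsilon> n) / (1 - T)\<^sup>2) / of_real ((\<epsilon> n)\<^sup>2))"
    define P1 P2 where "P1 = (1 - T) / (1 + T) ^ 3" and "P2 = (1 + T) / (1 - T) ^ 3"
    have R1: "R1 \<longlonglongrightarrow> - ((of_real q)\<^sup>2 / 2) * P1" and R2: "R2 \<longlonglongrightarrow> - ((of_real q)\<^sup>2 / 2) * P2"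
      using moebius_expansion_limit[OF \<epsilon>0, of t q] moebius_expansion_limit[OF \<epsilon>0, of "-t" q] \<epsilon>_pos t
      by (simp_all add: less_imp_neq[symmetric] R1_def R2_def s_def T_def P1_def P2_def)
    define x y A B c where "x = complex_of_real (Re z0)" and "y = complex_of_real (Im z0)"
      and "A = complex_of_real (Re a)" and "B = complex_of_real (Im a)" and "c = complex_of_real (1 - t\<^sup>2)"
    define E where "E n = complex_of_real (\<epsilon> n)" for n
    define u where "u = \<i> * complex_of_real q"
    \<comment> \<open>The exponent of the characteristic function, centred at \<open>Suc n\<close>
      rather than at n.\<close>
    define Z where "Z n = of_real (real (Suc n)) * (pgf_exponent t (z n) (s n) - pgf_exponent t (z n) 1)
        - of_real (real (Suc n)) * u * E n - u * of_real m" for n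
    have E0: "E n \<noteq> 0" for n using \<epsilon>_pos[of n] by (simp add: E_def)
    have one: "c * (x\<^sup>2 * K1 + y\<^sup>2 * K2) = 1"
      using arg_cong[OF bd[unfolded ellipse_form_eq[OF t]], of complex_of_real]
      by (simp add: c_def x_def y_def K1_def K2_def T_def)
    have m': "c * (2 * x * A * K1 + 2 * y * B * K2) = of_real m"
      unfolding m by (simp add: c_def x_def y_def K1_def K2_def T_def A_def B_def)
    have Z_eq: "Z n = u * E n * c * (A\<^sup>2 * K1 + B\<^sup>2 * K2) + c * ((x + A * E n)\<^sup>2 * R1 n + (y + B * E n)\<^sup>2 * R2 n)" for n
    proof -
      have k1: "s n / (1 + T * s n) - 1 / (1 + T) = u * E n * K1 + (E n)\<^sup>2 * R1 n"
        using E0[of n] by (simp add: R1_def K1_def u_def E_def)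
      have k2: "s n / (1 - T * s n) - 1 / (1 - T) = u * E n * K2 + (E n)\<^sup>2 * R2 n"
        using E0[of n] by (simp add: R2_def K2_def u_def E_def)
      have "pgf_exponent t (z n) (s n) - pgf_exponent t (z n) 1
        = c * ((x + A * E n)\<^sup>2 * (s n / (1 + T * s n) - 1 / (1 + T)) + (y + B * E n)\<^sup>2 * (s n / (1 - T * s n) - 1 / (1 - T)))"
        unfolding pgf_exponent_def z_eq
        by (simp add: c_def x_def y_def A_def B_def E_def T_def right_diff_distrib distrib_left)
      then have "Z n = (c * ((x + A * E n)\<^sup>2 * (u * E n * K1 + (E n)\<^sup>2 * R1 n) + (y + B * E n)\<^sup>2 * (u * E n * K2 + (E n)\<^sup>2 * R2 n)) - u * E n) / (E n)\<^sup>2 - u * of_real m"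
        unfolding Z_def k1 k2 \<epsilon>2 by (simp add: E_def diff_divide_distrib)
      also have "\<dots> = u * E n * c * (A\<^sup>2 * K1 + B\<^sup>2 * K2) + c * ((x + A * E n)\<^sup>2 * R1 n + (y + B * E n)\<^sup>2 * R2 n)"
        by (rule clt_exponent_identity[OF E0 one m'])
      finally show ?thesis .
    qed
    have E_lim: "E \<longlonglongrightarrow> 0"
      unfolding E_def using tendsto_of_real[OF \<epsilon>0] by simp
    have "Z \<longlonglongrightarrow> u * 0 * c * (A\<^sup>2 * K1 + B\<^sup>2 * K2) + c * ((x + A * 0)\<^sup>2 * (- ((of_real q)\<^sup>2 / 2) * P1)
        + (y + B * 0)\<^sup>2 * (- ((of_real q)\<^sup>2 / 2) * P2))"
      unfolding Z_eq by (intro tendsto_intros E_lim R1 R2)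
    also have "u * 0 * c * (A\<^sup>2 * K1 + B\<^sup>2 * K2) + c * ((x + A * 0)\<^sup>2 * (- ((of_real q)\<^sup>2 / 2) * P1)
        + (y + B * 0)\<^sup>2 * (- ((of_real q)\<^sup>2 / 2) * P2)) = - ((of_real q)\<^sup>2 / 2) * (c * (x\<^sup>2 * P1 + y\<^sup>2 * P2))"
      by (simp add: algebra_simps)
    also have "c * (x\<^sup>2 * P1 + y\<^sup>2 * P2) = of_real (\<sigma>\<^sup>2)"
      unfolding \<sigma>(2) by (simp add: c_def x_def y_def T_def P1_def P2_def)
    also have "- ((complex_of_real q)\<^sup>2 / 2) * of_real (\<sigma>\<^sup>2) = of_real (- (q\<^sup>2) / 2 * \<sigma>\<^sup>2)" by simp
    also have "- (q\<^sup>2) / 2 * \<sigma>\<^sup>2 = - \<theta>\<^sup>2 / 2" using \<sigma>(1) by (simp add: q_def power_divide)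
    finally have Z_lim: "Z \<longlonglongrightarrow> of_real (- \<theta>\<^sup>2 / 2)" .
    have s_lim: "s \<longlonglongrightarrow> 1"
    proof -
      have "s \<longlonglongrightarrow> exp (\<i> * of_real (q * 0))" unfolding s_def by (intro tendsto_intros \<epsilon>0)
      then show ?thesis by simp
    qed
    have csqrt1: "csqrt (1 - (T * 1)\<^sup>2) = of_real (sqrt (1 - t\<^sup>2))"
      using csqrt_of_real_nonneg[of "1 - t\<^sup>2"] t by (simp add: T_def abs_square_le_1)
    \<comment> \<open>The limit of the radicand lies off the branch cut, so the principal square
      root is continuous there.\<close>
    have np: "1 - (T * 1)\<^sup>2 \<notin> \<real>\<^sub>\<le>\<^sub>0"
      by (rule one_minus_square_notin_nonpos_Reals) (use t in \<open>simp add: T_def\<close>)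
    have r0: "complex_of_real (sqrt (1 - t\<^sup>2)) \<noteq> 0" using t by (simp add: abs_square_eq_1)
    have cs: "(\<lambda>n. csqrt (1 - (T * s n)\<^sup>2)) \<longlonglongrightarrow> of_real (sqrt (1 - t\<^sup>2))"
      unfolding csqrt1[symmetric]
      by (rule isCont_tendsto_compose[OF continuous_at_csqrt[OF np]]) (intro tendsto_intros s_lim)
    have "(\<lambda>n. s n * (of_real (sqrt (1 - t\<^sup>2)) / csqrt (1 - (T * s n)\<^sup>2)) * exp (Z n))
      \<longlonglongrightarrow> 1 * (of_real (sqrt (1 - t\<^sup>2)) / of_real (sqrt (1 - t\<^sup>2))) * exp (of_real (- \<theta>\<^sup>2 / 2))"
      by (intro tendsto_intros s_lim cs Z_lim r0)
    also have "1 * (of_real (sqrt (1 - t\<^sup>2)) / of_real (sqrt (1 - t\<^sup>2))) * exp (complex_of_real (- \<theta>\<^sup>2 / 2))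
       = exp (- (of_real \<theta>)\<^sup>2 / 2)"
      using r0 by simp
    also have "(\<lambda>n. s n * (of_real (sqrt (1 - t\<^sup>2)) / csqrt (1 - (T * s n)\<^sup>2)) * exp (Z n))
       = (\<lambda>n. iexp (- (\<theta> * (real n * (\<epsilon> n / \<sigma>) + m / \<sigma>))) * pgf t (real (Suc n)) (z n) (iexp (\<theta> * (\<epsilon> n / \<sigma>))))"
    proof
      fix n
      have s_eq: "iexp (\<theta> * (\<epsilon> n / \<sigma>)) = s n" by (simp add: s_def q_def)
      have "s n * exp (Z n) = iexp (- (\<theta> * (real n * (\<epsilon> n / \<sigma>) + m / \<sigma>))) *
          exp (of_real (real (Suc n)) * (pgf_exponent t (z n) (s n) - pgf_exponent t (z n) 1))"
        unfolding s_def[of n] exp_add[symmetric] Z_def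
        by (rule arg_cong[of _ _ exp]) (simp add: s_def u_def E_def q_def add_divide_distrib algebra_simps)
      then show "s n * (of_real (sqrt (1 - t\<^sup>2)) / csqrt (1 - (T * s n)\<^sup>2)) * exp (Z n)
        = iexp (- (\<theta> * (real n * (\<epsilon> n / \<sigma>) + m / \<sigma>))) * pgf t (real (Suc n)) (z n) (iexp (\<theta> * (\<epsilon> n / \<sigma>)))"
        unfolding s_eq pgf_def T_def[symmetric] by (simp add: mult_ac)
    qed
    finally show "(\<lambda>n. iexp (- (\<theta> * (real n * (\<epsilon> n / \<sigma>) + m / \<sigma>))) * pgf t (real (Suc n)) (z n) (iexp (\<theta> * (\<epsilon> n / \<sigma>))))
       \<longlonglongrightarrow> exp (- (of_real \<theta>)\<^sup>2 / 2)" .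
  qed (rule w(1))
  from tendsto_mult_left[OF this, of "1 / pi"] show ?thesis
    unfolding w(3)[symmetric] z_def by (rule LIMSEQ_imp_Suc)
qed

text \<open>In the angle parameter the drift is \<open>2 * M / r\<close> and the deviation
  \<open>S / r\<close>, so \<open>r\<close> cancels. The factor \<open>sqrt 2\<close> of
  \<open>edge_zeta\<close> is this 2 divided by the \<open>sqrt 2\<close> relating the normal
  distribution function to \<open>erfc\<close>.\<close>

lemma density_boundary:
  fixes t \<phi> :: real and z0 a :: complex
  assumes t: "0 < t" "t < 1" and bd: "ellipse_form t z0 = 1"
    and z0: "z0 = complex_of_real (semi_axis_re t * cos \<phi>) + \<i> * complex_of_real (semi_axis_im t * sin \<phi>)"
  shows "(\<lambda>n. eigenvalue_density (elliptic_potential t) n (z0 + a / complex_of_real (sqrt (real n))))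
    \<longlonglongrightarrow> 1 / pi * (1 / 2 * erfc (edge_zeta t \<phi> a))"
proof -
  define r where "r = sqrt (1 - t\<^sup>2)"
  define S where "S = sqrt ((1 + t)\<^sup>2 - 4 * t * (cos \<phi>)\<^sup>2)"
  have "t\<^sup>2 < 1" using t by (simp add: abs_square_less_1)
  then have r: "r > 0" "r\<^sup>2 = (1 - t) * (1 + t)" "1 - t\<^sup>2 = r\<^sup>2"
    by (simp_all add: r_def) (simp add: algebra_simps power2_eq_square)
  have ax: "semi_axis_re t = (1 + t) / r" "semi_axis_im t = (1 - t) / r"
  proof -
    have "(1 + t) / (1 - t) = ((1 + t) / r)\<^sup>2" "(1 - t) / (1 + t) = ((1 - t) / r)\<^sup>2"
      unfolding power_divide r(2) using t by (simp_all add: divide_simps) (simp_all add: power2_eq_square)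
    then show "semi_axis_re t = (1 + t) / r" "semi_axis_im t = (1 - t) / r"
      using t r(1) by (simp_all add: semi_axis_re_def semi_axis_im_def)
  qed
  have re: "Re z0 = (1 + t) / r * cos \<phi>" "Im z0 = (1 - t) / r * sin \<phi>"
    by (simp_all add: z0 ax)
  have sc: "(sin \<phi>)\<^sup>2 = 1 - (cos \<phi>)\<^sup>2" by (simp add: sin_squared_eq)
  have S2: "(1 + t)\<^sup>2 - 4 * t * (cos \<phi>)\<^sup>2 = (1 - t)\<^sup>2 * (cos \<phi>)\<^sup>2 + (1 + t)\<^sup>2 * (sin \<phi>)\<^sup>2"
    unfolding sc by (simp add: power2_eq_square algebra_simps)
  \<comment> \<open>The radicand is smallest when the squared cosine is 1, where it equals
    \<open>(1 - t)\<^sup>2\<close>.\<close>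
  have "(1 - t)\<^sup>2 * 1 \<le> (1 + t)\<^sup>2 - 4 * t * (cos \<phi>)\<^sup>2"
  proof -
    have "4 * t * (cos \<phi>)\<^sup>2 \<le> 4 * t * 1" using t by (intro mult_left_mono) (auto simp: abs_square_le_1)
    then show ?thesis by (simp add: power2_eq_square algebra_simps)
  qed
  moreover have "(1 - t)\<^sup>2 > 0" using t by simp
  ultimately have pos: "(1 + t)\<^sup>2 - 4 * t * (cos \<phi>)\<^sup>2 > 0" by linarith
  then have S: "S > 0" by (simp add: S_def)
  have SS: "S\<^sup>2 = (1 - t)\<^sup>2 * (cos \<phi>)\<^sup>2 + (1 + t)\<^sup>2 * (sin \<phi>)\<^sup>2"
    unfolding S2[symmetric] S_def using pos by simp
  have red: "r\<^sup>2 * ((1 + t) / r * C / (1 + t)\<^sup>2) = (1 - t) * C / r" "r\<^sup>2 * ((1 - t) / r * C / (1 - t)\<^sup>2) = (1 + t) * C / r" for C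
    using t r(1) unfolding r(2) by (simp_all add: divide_simps) (simp_all add: power2_eq_square algebra_simps)
  define M where "M = (1 - t) * cos \<phi> * Re a + (1 + t) * sin \<phi> * Im a"
  have "(\<lambda>n. eigenvalue_density (elliptic_potential t) n (z0 + a / complex_of_real (sqrt (real n))))
    \<longlonglongrightarrow> 1 / pi * cdf std_normal_distribution (- (2 * M / r) / (S / r))"
  proof (rule density_boundary_cdf[OF t bd])
    have "(1 - t\<^sup>2) * (2 * Re z0 * Re a / (1 + t)\<^sup>2 + 2 * Im z0 * Im a / (1 - t)\<^sup>2)
       = r\<^sup>2 * ((1 + t) / r * (2 * cos \<phi> * Re a) / (1 + t)\<^sup>2) + r\<^sup>2 * ((1 - t) / r * (2 * sin \<phi> * Im a) / (1 - t)\<^sup>2)"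
      unfolding r(3) re distrib_left by (simp add: mult_ac)
    also have "\<dots> = 2 * M / r" unfolding red by (simp add: M_def add_divide_distrib distrib_left mult_ac)
    finally show "2 * M / r = (1 - t\<^sup>2) * (2 * Re z0 * Re a / (1 + t)\<^sup>2 + 2 * Im z0 * Im a / (1 - t)\<^sup>2)" by simp
    show "S / r > 0" using S r by simp
    have q: "(1 + t)\<^sup>2 * C * (1 - t) / (1 + t) ^ 3 = (1 - t)\<^sup>2 * C / r\<^sup>2"
      "(1 - t)\<^sup>2 * C * (1 + t) / (1 - t) ^ 3 = (1 + t)\<^sup>2 * C / r\<^sup>2" for C
      unfolding r(2) using t by (simp_all add: divide_simps) (simp_all add: power2_eq_square power3_eq_cube)
    have "(1 - t\<^sup>2) * ((Re z0)\<^sup>2 * (1 - t) / (1 + t) ^ 3 + (Im z0)\<^sup>2 * (1 + t) / (1 - t) ^ 3)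
      = (1 + t)\<^sup>2 * (cos \<phi>)\<^sup>2 * (1 - t) / (1 + t) ^ 3 + (1 - t)\<^sup>2 * (sin \<phi>)\<^sup>2 * (1 + t) / (1 - t) ^ 3"
      unfolding r(3) re using r(1) by (simp add: power_mult_distrib power_divide distrib_left)
    also have "\<dots> = (S / r)\<^sup>2" unfolding q power_divide SS by (simp add: add_divide_distrib)
    finally show "(S / r)\<^sup>2 = (1 - t\<^sup>2) * ((Re z0)\<^sup>2 * (1 - t) / (1 + t) ^ 3 + (Im z0)\<^sup>2 * (1 + t) / (1 - t) ^ 3)" by simp
  qed
  also have "- (2 * M / r) / (S / r) = - 2 * M / S" using r S by simp
  also have "cdf std_normal_distribution (- 2 * M / S) = 1 / 2 * erfc (- (- 2 * M / S) / sqrt 2)"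
    by (rule cdf_std_normal_erfc)
  also have "- (- 2 * M / S) / sqrt 2 = edge_zeta t \<phi> a"
    unfolding edge_zeta_def S_def[symmetric] M_def[symmetric] using S
    by (simp add: divide_simps)
  finally show ?thesis .
qed

theorem theorem7p5:
  fixes t :: real and z0 a :: complex and \<rho> :: "nat \<Rightarrow> complex \<Rightarrow> real"
  assumes "0 < t" and "t < 1"
  defines "\<rho> \<equiv> eigenvalue_density (elliptic_potential t)"
  shows "(z0 \<in> ellipse_inside t \<longrightarrow>
            (\<lambda>n. \<rho> n (z0 + a / complex_of_real (sqrt (real n)))) \<longlonglongrightarrow> 1 / pi * 1) \<and>
         (z0 \<in> ellipse_boundary t \<longrightarrow>
            (\<forall>\<phi>::real. z0 = complex_of_real (semi_axis_re t * cos \<phi>)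
                         + \<i> * complex_of_real (semi_axis_im t * sin \<phi>) \<longrightarrow>
               (\<lambda>n. \<rho> n (z0 + a / complex_of_real (sqrt (real n))))
                 \<longlonglongrightarrow> 1 / pi * (1 / 2 * erfc (edge_zeta t \<phi> a)))) \<and>
         (z0 \<in> ellipse_outside t \<longrightarrow>
            (\<lambda>n. \<rho> n (z0 + a / complex_of_real (sqrt (real n)))) \<longlonglongrightarrow> 1 / pi * 0)"
proof -
  have "(\<lambda>n. complex_of_real (1 / sqrt (real n))) \<longlonglongrightarrow> of_real 0"
    by (intro tendsto_of_real real_tendsto_divide_at_top[OF tendsto_const]
        filterlim_compose[OF sqrt_at_top filterlim_real_sequentially])
  from tendsto_add[OF tendsto_const[of z0] tendsto_mult_left[OF this, of a]]
  have z: "(\<lambda>n. z0 + a / complex_of_real (sqrt (real n))) \<longlonglongrightarrow> z0" by (simp add: divide_inverse)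
  show ?thesis
    using density_inside[OF assms(1,2) z] density_boundary[OF assms(1,2)] density_outside[OF assms(1,2) z]
    by (auto simp: \<rho>_def ellipse_inside_def ellipse_boundary_def ellipse_outside_def)
qed

end
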